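(* Let $1<p\le\infty$. There is a constant $C=C(p)>0$ such that for all $\omega,\eta\in L^p(\mathbb R^2_+)$ satisfying $x_2\omega,x_2\eta\in L^1(\mathbb R^2_+)$, $$\iint_{\mathbb R^2_+\times\mathbb R^2_+}G(\mathbf x,\mathbf y)\,|\omega(\mathbf x)\eta(\mathbf y)|\,d\mathbf x\,d\mathbf y\le C\,\|x_2\omega\|_1^{\frac{2p-2}{3p-2}}\|\omega\|_p^{\frac p{3p-2}}\|x_2\eta\|_1^{\frac{2p-2}{3p-2}}\|\eta\|_p^{\frac p{3p-2}},$$ $$E(\omega)\le C\,\|x_2\omega\|_1^{\frac{4p-4}{3p-2}}\|\omega\|_p^{\frac{2p}{3p-2}},$$ $$|E(\omega)-E(\eta)|\le C\,\|x_2(\omega+\eta)\|_1^{\frac{2p-2}{3p-2}}\|\omega+\eta\|_p^{\frac p{3p-2}}\|x_2(\omega-\eta)\|_1^{\frac{2p-2}{3p-2}}\|\omega-\eta\|_p^{\frac p{3p-2}}.$$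
   Context: $\mathbb R^2_+=\{\mathbf x=(x_1,x_2)\in\mathbb R^2:x_2>0\}$; $\|\cdot\|_p$ is the norm of $L^p(\mathbb R^2_+)$; $x_2\omega$ denotes $\mathbf x\mapsto x_2\omega(\mathbf x)$. $G(\mathbf x,\mathbf y)=\frac1{4\pi}\log\big(1+\frac{4x_2y_2}{|\mathbf x-\mathbf y|^2}\big)$ and $E(\omega)=\frac12\iint_{\mathbb R^2_+\times\mathbb R^2_+}G(\mathbf x,\mathbf y)\omega(\mathbf x)\omega(\mathbf y)\,d\mathbf x\,d\mathbf y$. For $p=\infty$ the exponents are understood as limits: $\frac{2p-2}{3p-2}=\frac23$, $\frac p{3p-2}=\frac13$, $\frac{4p-4}{3p-2}=\frac43$, $\frac{2p}{3p-2}=\frac23$. *)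

theory Defs
  imports "HOL-Analysis.Analysis" "HOL-Probability.Essential_Supremum"
begin

text \<open>Points of the plane are pairs \<open>(x\<^sub>1, x\<^sub>2)\<close>; the library norm on \<open>real \<times> real\<close> is
  the Euclidean one.\<close>

definition half_plane :: "(real \<times> real) set" where
  "half_plane = {x. snd x > 0}"

abbreviation half_plane_measure :: "(real \<times> real) measure" where
  "half_plane_measure \<equiv> lebesgue_on half_plane"

text \<open>The space \<open>L\<^sup>p\<close> of real-valued functions and its norm, for an exponent \<open>1 \<le> p \<le> \<infinity>\<close>.
  Members are functions rather than classes of functions modulo null sets. The value of
  \<open>Lp_norm\<close> is meaningful only on members of \<open>Lp_space\<close>.\<close>

definition Lp_space :: "'a measure \<Rightarrow> ennreal \<Rightarrow> ('a \<Rightarrow> real) set" where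
  "Lp_space M p = {f \<in> borel_measurable M.
     if p = \<infinity> then esssup M (\<lambda>x. ennreal \<bar>f x\<bar>) < \<infinity>
     else integrable M (\<lambda>x. \<bar>f x\<bar> powr enn2real p)}"

definition Lp_norm :: "'a measure \<Rightarrow> ennreal \<Rightarrow> ('a \<Rightarrow> real) \<Rightarrow> real" where
  "Lp_norm M p f =
     (if p = \<infinity> then enn2real (esssup M (\<lambda>x. ennreal \<bar>f x\<bar>))
      else (LINT x|M. \<bar>f x\<bar> powr enn2real p) powr (1 / enn2real p))"

text \<open>On the diagonal, where the kernel is infinite, division by zero makes \<open>green x x = 0\<close>;
  the diagonal is a null set of the product measure, so no integral below is affected.\<close>

definition green :: "real \<times> real \<Rightarrow> real \<times> real \<Rightarrow> real" where
  "green x y = 1 / (4 * pi) * ln (1 + 4 * snd x * snd y / (norm (x - y))\<^sup>2)"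

definition kinetic_energy :: "(real \<times> real \<Rightarrow> real) \<Rightarrow> real" where
  "kinetic_energy \<omega> =
     1 / 2 * (\<integral>(x, y). green x y * \<omega> x * \<omega> y \<partial>(half_plane_measure \<Otimes>\<^sub>M half_plane_measure))"

text \<open>The exponent \<open>(a p - b) / (3 p - 2)\<close>, with its limit \<open>a / 3\<close> at \<open>p = \<infinity>\<close>.\<close>

definition exponent :: "real \<Rightarrow> real \<Rightarrow> ennreal \<Rightarrow> real" where
  "exponent a b p =
     (if p = \<infinity> then a / 3 else (a * enn2real p - b) / (3 * enn2real p - 2))"

end

theory Submission
  imports Defs
begin

text \<open>Write \<open>s = (2p - 2) / (3p - 2)\<close>. Since \<open>ln (1 + t) \<le> (2 / \<tau>) t\<^sup>\<tau>\<close>, the kernel is at most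
  \<open>(x\<^sub>2 y\<^sub>2)\<^sup>\<tau> |x - y|\<^bsup>-2\<tau>\<^esup> / \<tau>\<close> for every \<open>0 < \<tau> < 1\<close>. The function \<open>x\<^sub>2\<^sup>\<tau> |\<omega>|\<close> interpolates between
  \<open>x\<^sub>2 \<omega> \<in> L\<^sup>1\<close> and \<open>\<omega> \<in> L\<^sup>p\<close>, so it lies in \<open>L\<^sup>q\<close> with \<open>1 / q = \<theta> = \<tau> + (1 - \<tau>) / p\<close>, and Young's
  convolution inequality asks for the kernel in \<open>L\<^sup>m\<close> with \<open>1 / m = 2 - 2\<theta>\<close>. The power kernel
  misses this space logarithmically exactly at \<open>\<tau> = s\<close> (the Hardy-Littlewood-Sobolev case); it is
  \<open>m\<close>-integrable near the origin for \<open>\<tau> < s\<close> and away from it for \<open>\<tau> > s\<close>. Using \<open>\<tau> = 3s/4\<close> for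
  \<open>|x - y| < R\<close> and \<open>\<tau> = 5s/4\<close> for \<open>|x - y| \<ge> R\<close>, and then the best \<open>R\<close>, gives the bilinear bound without
  the Hardy-Littlewood-Sobolev inequality. The energy difference is the bilinear form at
  \<open>(\<omega> + \<eta>, \<omega> - \<eta>)\<close>, by symmetry of the kernel.\<close>

section \<open>Elementary inequalities and the pointwise power bound for the Green function\<close>

text \<open>Concavity of the logarithm: its tangent line at the weighted mean \<open>S\<close> lies
  above the graph, and averaging the tangent bounds with the weights leaves \<open>ln S\<close>. If
  a base is 0, the left side is 0 even for exponent 0, because \<open>0 powr 0 = 0\<close>.\<close>

lemma weighted_am_gm3:
  fixes x y z a b c :: real
  assumes "0 \<le> x" "0 \<le> y" "0 \<le> z" "0 \<le> a" "0 \<le> b" "0 \<le> c" "a + b + c = 1"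
  shows "x powr a * y powr b * z powr c \<le> a * x + b * y + c * z"
proof (cases "x = 0 \<or> y = 0 \<or> z = 0")
  case True
  then show ?thesis using assms by auto
next
  case False
  then have pos: "0 < x" "0 < y" "0 < z" using assms by auto
  define S where "S = a * x + b * y + c * z"
  have S: "0 < S"
  proof -
    have "0 < a \<or> 0 < b \<or> 0 < c" using assms by linarith
    then show ?thesis
      using pos assms unfolding S_def
      by (smt (verit) mult_nonneg_nonneg mult_pos_pos)
  qed
  have *: "ln u \<le> ln S + (u / S - 1)" if "0 < u" for u
    using ln_le_minus_one[of "u / S"] that S by (simp add: ln_div)
  have "a * ln x + b * ln y + c * ln z
      \<le> a * (ln S + (x / S - 1)) + b * (ln S + (y / S - 1)) + c * (ln S + (z / S - 1))"
    using * pos assms by (intro add_mono mult_left_mono) auto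
  also have "\<dots> = (a + b + c) * (ln S - 1) + (a * x + b * y + c * z) / S"
    by (simp add: algebra_simps add_divide_distrib)
  also have "\<dots> = ln S" using S assms unfolding S_def[symmetric] by simp
  finally have "exp (a * ln x + b * ln y + c * ln z) \<le> S"
    using S by (metis exp_le_cancel_iff exp_ln)
  then show ?thesis using pos by (simp add: S_def powr_def exp_add)
qed

text \<open>For \<open>t \<le> 1\<close> the logarithm is at most \<open>t\<close>, hence at most
  \<open>t powr \<tau>\<close>. For larger \<open>t\<close>, \<open>1 + t \<le> 2 * t\<close>, and
  bounding the logarithm of \<open>(2 * t) powr \<tau>\<close> by its argument produces the factor
  \<open>1 / \<tau>\<close>.\<close>

lemma ln_one_plus_le_powr:
  fixes t \<tau> :: real
  assumes "0 \<le> t" "0 < \<tau>" "\<tau> \<le> 1"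
  shows "ln (1 + t) \<le> 2 / \<tau> * t powr \<tau>"
proof (cases "t \<le> 1")
  case True
  have "ln (1 + t) \<le> t" using assms ln_add_one_self_le_self by blast
  also have "t \<le> t powr \<tau>"
    using assms True powr_mono'[of \<tau> 1 t] by (cases "t = 0") auto
  also have "\<dots> \<le> 2 / \<tau> * t powr \<tau>"
    using assms mult_right_mono[of 1 "2 / \<tau>" "t powr \<tau>"] by (simp add: field_simps)
  finally show ?thesis .
next
  case False
  then have t: "1 < t" by simp
  have "\<tau> * ln (1 + t) \<le> \<tau> * ln (2 * t)" using assms t by simp
  also have "\<dots> = ln ((2 * t) powr \<tau>)" using t by (simp add: ln_powr)
  also have "\<dots> \<le> (2 * t) powr \<tau>"
    using t ln_le_minus_one[of "(2 * t) powr \<tau>"] by simp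
  also have "\<dots> \<le> 2 * t powr \<tau>"
    using assms t powr_mono[of \<tau> 1 2] by (simp add: powr_mult)
  finally show ?thesis using assms by (simp add: field_simps)
qed

text \<open>The constants of \<open>ln_one_plus_le_powr\<close> are absorbed:
  \<open>4 powr \<tau>\<close> is at most 4, and the remaining 8 / (4 pi) = 2 / pi is at most 1. On
  the diagonal both sides are 0, by division by zero on the left and a power of base 0 on the
  right.\<close>

lemma green_le:
  assumes "0 < \<tau>" "\<tau> \<le> 1" "0 \<le> snd x" "0 \<le> snd y"
  shows "green x y \<le> 1 / \<tau> * (snd x powr \<tau> * snd y powr \<tau> * norm (x - y) powr (- 2 * \<tau>))"
proof (cases "x = y")
  case True
  then show ?thesis by (simp add: green_def)
next
  case False
  let ?P = "snd x powr \<tau> * snd y powr \<tau> * norm (x - y) powr (- 2 * \<tau>)"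
  have n: "0 < norm (x - y)" using False by simp
  have sq: "((norm (x - y))\<^sup>2) powr \<tau> = norm (x - y) powr (2 * \<tau>)"
    using n by (simp add: powr_powr flip: powr_numeral)
  have "(4 * snd x * snd y / (norm (x - y))\<^sup>2) powr \<tau>
      = 4 powr \<tau> * snd x powr \<tau> * snd y powr \<tau> / norm (x - y) powr (2 * \<tau>)"
    using assms by (simp add: powr_divide powr_mult sq)
  also have "\<dots> = 4 powr \<tau> * ?P"
    using powr_minus_divide[of "norm (x - y)" "2 * \<tau>"] by simp
  finally have base: "(4 * snd x * snd y / (norm (x - y))\<^sup>2) powr \<tau> = 4 powr \<tau> * ?P" .
  have "green x y \<le> 1 / (4 * pi) * (2 / \<tau> * (4 * snd x * snd y / (norm (x - y))\<^sup>2) powr \<tau>)"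
    unfolding green_def using assms by (intro mult_left_mono ln_one_plus_le_powr) auto
  also have "\<dots> = 1 / (4 * pi) * (2 / \<tau> * (4 powr \<tau> * ?P))"
    by (simp only: base)
  also have "\<dots> \<le> 1 / (4 * pi) * (2 / \<tau> * (4 * ?P))"
    using assms powr_mono[of \<tau> 1 4] by (intro mult_left_mono mult_right_mono) auto
  also have "\<dots> = (2 / pi) * (1 / \<tau> * ?P)" by simp
  also have "\<dots> \<le> 1 * (1 / \<tau> * ?P)"
    using assms pi_ge_two by (intro mult_right_mono) auto
  finally show ?thesis by simp
qed

lemma green_nonneg: "0 \<le> snd x \<Longrightarrow> 0 \<le> snd y \<Longrightarrow> 0 \<le> green x y"
  by (simp add: green_def)

lemma green_commute: "green x y = green y x"
  by (simp add: green_def norm_minus_commute mult.commute mult.left_commute)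

section \<open>Integrals of negative powers of the norm near the origin and away from it\<close>

lemma nn_integral_powr_near_zero:
  fixes e R :: real
  assumes "e < 1" "0 < R"
  shows "(\<integral>\<^sup>+ a. ennreal (\<bar>a\<bar> powr (- e) * indicator {..<R} \<bar>a\<bar>) \<partial>lborel) \<le> ennreal (2 / (1 - e) * R powr (1 - e))"
proof -
  let ?g = "\<lambda>a::real. ennreal (a powr (- e)) * indicator {0..R} a"
  have I: "(\<integral>\<^sup>+ a. ?g a \<partial>lborel) = ennreal (R powr (1 - e) / (1 - e))"
    using nn_integral_has_integral_lebesgue'[OF _ has_integral_powr_from_0[of "- e" R]] assms by simp
  have J: "(\<integral>\<^sup>+ a. ?g (- a) \<partial>lborel) = (\<integral>\<^sup>+ a. ?g a \<partial>lborel)"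
    by (subst nn_integral_real_affine[of ?g "- 1" 0]) auto
  have "(\<integral>\<^sup>+ a. ennreal (\<bar>a\<bar> powr (- e) * indicator {..<R} \<bar>a\<bar>) \<partial>lborel) \<le> (\<integral>\<^sup>+ a. ?g a + ?g (- a) \<partial>lborel)"
    by (intro nn_integral_mono) (auto simp: indicator_def)
  also have "\<dots> = 2 * ennreal (R powr (1 - e) / (1 - e))"
    by (subst nn_integral_add) (auto simp: I J mult_2)
  also have "\<dots> = ennreal (2 / (1 - e) * R powr (1 - e))"
    using assms by (simp flip: ennreal_numeral ennreal_mult)
  finally show ?thesis .
qed

text \<open>A point outside a disc may still have one small coordinate, so each factor of a product
  majorant must be integrable on the whole line; hence \<open>max R \<bar>a\<bar>\<close>. The flat
  part contributes the constant 2, the two tails \<open>2 / (e - 1)\<close>.\<close>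

lemma nn_integral_powr_away_zero:
  fixes e R :: real
  assumes "1 < e" "0 < R"
  shows "(\<integral>\<^sup>+ a. ennreal ((max R \<bar>a\<bar>) powr (- e)) \<partial>lborel) \<le> ennreal ((2 + 2 / (e - 1)) * R powr (1 - e))"
proof -
  let ?g = "\<lambda>a::real. ennreal (a powr (- e)) * indicator {R..} a"
  let ?h = "\<lambda>a::real. ennreal (R powr (- e)) * indicator {- R..R} a"
  have "((\<lambda>x. x powr - e) has_integral R powr (1 - e) / (e - 1)) {R..}"
    using has_integral_powr_to_inf[of "- e" R] assms
    by (simp add: minus_divide_right)
  then have I: "(\<integral>\<^sup>+ a. ?g a \<partial>lborel) = ennreal (R powr (1 - e) / (e - 1))"
    using nn_integral_has_integral_lebesgue'[of "{R..}" "\<lambda>x. x powr - e"] assms by simp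
  have J: "(\<integral>\<^sup>+ a. ?g (- a) \<partial>lborel) = (\<integral>\<^sup>+ a. ?g a \<partial>lborel)"
    by (subst nn_integral_real_affine[of ?g "- 1" 0]) auto
  have K: "(\<integral>\<^sup>+ a. ?h a \<partial>lborel) = ennreal (2 * R powr (1 - e))"
    using assms powr_add[of R 1 "- e"]
    by (subst nn_integral_cmult_indicator) (auto simp: mult_ac simp flip: ennreal_mult')
  have "(\<integral>\<^sup>+ a. ennreal ((max R \<bar>a\<bar>) powr (- e)) \<partial>lborel) \<le> (\<integral>\<^sup>+ a. ?h a + (?g a + ?g (- a)) \<partial>lborel)"
    by (intro nn_integral_mono) (use assms in \<open>auto simp: indicator_def max_def\<close>)
  also have "\<dots> = (\<integral>\<^sup>+ a. ?h a \<partial>lborel) + ((\<integral>\<^sup>+ a. ?g a \<partial>lborel) + (\<integral>\<^sup>+ a. ?g (- a) \<partial>lborel))"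
    by (subst nn_integral_add, measurable, subst nn_integral_add, measurable)
  also have "\<dots> = ennreal (2 * R powr (1 - e)) + 2 * ennreal (R powr (1 - e) / (e - 1))"
    by (simp only: I J K mult_2)
  also have "\<dots> = ennreal (2 * R powr (1 - e) + 2 * (R powr (1 - e) / (e - 1)))"
    using assms by (simp flip: ennreal_numeral ennreal_mult ennreal_plus)
  also have "2 * R powr (1 - e) + 2 * (R powr (1 - e) / (e - 1)) = (2 + 2 / (e - 1)) * R powr (1 - e)"
    by (simp add: algebra_simps)
  finally show ?thesis .
qed

text \<open>Tonelli for a product majorant, which reduces plane integrals to integrals on the line.
  The majorant is asked for off the axes only, because a negative power of base 0 is 0 and a
  singular majorant would vanish there.\<close>

lemma nn_integral_plane_le_square:
  fixes F :: "real \<times> real \<Rightarrow> real" and g :: "real \<Rightarrow> real"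
  assumes [measurable]: "F \<in> borel_measurable borel" "g \<in> borel_measurable borel"
    and g: "\<And>a. 0 \<le> g a"
    and le: "\<And>a b. a \<noteq> 0 \<Longrightarrow> b \<noteq> 0 \<Longrightarrow> F (a, b) \<le> g a * g b"
    and c: "0 \<le> c" "(\<integral>\<^sup>+ a. ennreal (g a) \<partial>lborel) \<le> ennreal c"
  shows "(\<integral>\<^sup>+ z. ennreal (F z) \<partial>lborel) \<le> ennreal (c\<^sup>2)"
proof -
  have "(\<lambda>z. ennreal (F z)) \<in> borel_measurable (lborel \<Otimes>\<^sub>M lborel)"
    by (simp add: lborel_prod)
  from lborel.nn_integral_fst[OF this]
  have "(\<integral>\<^sup>+ z. ennreal (F z) \<partial>lborel) = (\<integral>\<^sup>+ a. \<integral>\<^sup>+ b. ennreal (F (a, b)) \<partial>lborel \<partial>lborel)"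
    by (simp add: lborel_prod)
  \<comment> \<open>The values \<open>a = 0\<close> and \<open>b = 0\<close> are null sets in the
    iterated integrals, so the axes may be left out.\<close>
  also have "\<dots> \<le> (\<integral>\<^sup>+ a. \<integral>\<^sup>+ b. ennreal (g a) * ennreal (g b) \<partial>lborel \<partial>lborel)"
  proof (rule nn_integral_mono_AE, rule eventually_mono[OF AE_lborel_singleton[of 0]])
    fix a :: real assume a: "a \<noteq> 0"
    show "(\<integral>\<^sup>+ b. ennreal (F (a, b)) \<partial>lborel) \<le> (\<integral>\<^sup>+ b. ennreal (g a) * ennreal (g b) \<partial>lborel)"
      by (rule nn_integral_mono_AE, rule eventually_mono[OF AE_lborel_singleton[of 0]])
        (use le[OF a] g in \<open>auto simp flip: ennreal_mult intro: ennreal_leI\<close>)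
  qed
  also have "\<dots> = (\<integral>\<^sup>+ a. ennreal (g a) \<partial>lborel) * (\<integral>\<^sup>+ a. ennreal (g a) \<partial>lborel)"
    by (simp add: nn_integral_cmult nn_integral_multc)
  also have "\<dots> \<le> ennreal c * ennreal c" by (intro mult_mono c) auto
  also have "\<dots> = ennreal (c\<^sup>2)" using c by (simp add: power2_eq_square flip: ennreal_mult)
  finally show ?thesis .
qed

text \<open>Each coordinate is at most the norm, so one half of the negative power is given to each
  coordinate, and the disc lies in the square of half-side \<open>R\<close>. Since
  \<open>d < 2\<close>, each factor has an integrable singularity.\<close>

lemma nn_integral_norm_powr_near:
  fixes d R :: real
  assumes "0 \<le> d" "d < 2" "0 < R"
  shows "(\<integral>\<^sup>+ z. ennreal (norm (z :: real \<times> real) powr (- d) * indicator {z. norm z < R} z) \<partial>lborel)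
    \<le> ennreal ((2 / (1 - d / 2))\<^sup>2 * R powr (2 - d))"
proof -
  let ?c = "2 / (1 - d / 2) * R powr (1 - d / 2)"
  have sq: "(R powr (1 - d / 2))\<^sup>2 = R powr (2 - d)"
    by (simp add: power2_eq_square flip: powr_add)
  have "(\<integral>\<^sup>+ z. ennreal (norm (z :: real \<times> real) powr (- d) * indicator {z. norm z < R} z) \<partial>lborel) \<le> ennreal (?c\<^sup>2)"
  proof (rule nn_integral_plane_le_square[where g = "\<lambda>a. \<bar>a\<bar> powr (- (d / 2)) * indicator {..<R} \<bar>a\<bar>"])
    fix a b :: real assume ab: "a \<noteq> 0" "b \<noteq> 0"
    have le: "\<bar>a\<bar> \<le> norm (a, b)" "\<bar>b\<bar> \<le> norm (a, b)"
      using norm_fst_le[of a b] norm_snd_le[of b a] by auto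
    have "norm (a, b) powr (- d) = norm (a, b) powr (- (d / 2)) * norm (a, b) powr (- (d / 2))"
      by (simp flip: powr_add)
    also have "\<dots> \<le> \<bar>a\<bar> powr (- (d / 2)) * \<bar>b\<bar> powr (- (d / 2))"
      using le ab assms by (intro mult_mono powr_mono2') auto
    finally show "norm (a, b) powr (- d) * indicator {z. norm z < R} (a, b)
      \<le> \<bar>a\<bar> powr (- (d / 2)) * indicator {..<R} \<bar>a\<bar> * (\<bar>b\<bar> powr (- (d / 2)) * indicator {..<R} \<bar>b\<bar>)"
      using le by (auto simp: indicator_def)
  qed (use assms nn_integral_powr_near_zero[of "d / 2" R] in auto)
  also have "?c\<^sup>2 = (2 / (1 - d / 2))\<^sup>2 * R powr (2 - d)"
    using sq by (simp only: power_mult_distrib)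
  finally show ?thesis .
qed

text \<open>Outside the disc the norm dominates both \<open>max R \<bar>a\<bar>\<close> and
  \<open>max R \<bar>b\<bar>\<close>; the power is again shared equally, and \<open>d > 2\<close>
  makes each factor integrable at infinity.\<close>

lemma nn_integral_norm_powr_far:
  fixes d R :: real
  assumes "2 < d" "0 < R"
  shows "(\<integral>\<^sup>+ z. ennreal (norm (z :: real \<times> real) powr (- d) * indicator (- {z. norm z < R}) z) \<partial>lborel)
    \<le> ennreal ((2 + 2 / (d / 2 - 1))\<^sup>2 * R powr (2 - d))"
proof -
  let ?c = "(2 + 2 / (d / 2 - 1)) * R powr (1 - d / 2)"
  have sq: "(R powr (1 - d / 2))\<^sup>2 = R powr (2 - d)"
    by (simp add: power2_eq_square flip: powr_add)
  have "(\<integral>\<^sup>+ z. ennreal (norm (z :: real \<times> real) powr (- d) * indicator (- {z. norm z < R}) z) \<partial>lborel) \<le> ennreal (?c\<^sup>2)"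
  proof (rule nn_integral_plane_le_square[where g = "\<lambda>a. max R \<bar>a\<bar> powr (- (d / 2))"])
    fix a b :: real
    have le: "\<bar>a\<bar> \<le> norm (a, b)" "\<bar>b\<bar> \<le> norm (a, b)"
      using norm_fst_le[of a b] norm_snd_le[of b a] by auto
    show "norm (a, b) powr (- d) * indicator (- {z. norm z < R}) (a, b)
      \<le> max R \<bar>a\<bar> powr (- (d / 2)) * max R \<bar>b\<bar> powr (- (d / 2))"
    proof (cases "norm (a, b) < R")
      case False
      have "norm (a, b) powr (- d) = norm (a, b) powr (- (d / 2)) * norm (a, b) powr (- (d / 2))"
        by (simp flip: powr_add)
      also have "\<dots> \<le> max R \<bar>a\<bar> powr (- (d / 2)) * max R \<bar>b\<bar> powr (- (d / 2))"
        using le False assms by (intro mult_mono powr_mono2') auto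
      finally show ?thesis by (simp add: indicator_def)
    qed simp
  qed (use assms nn_integral_powr_away_zero[of "d / 2" R] in auto)
  also have "?c\<^sup>2 = (2 + 2 / (d / 2 - 1))\<^sup>2 * R powr (2 - d)"
    using sq by (simp only: power_mult_distrib)
  finally show ?thesis .
qed

section \<open>Young's convolution inequality in normalised form\<close>

text \<open>The three-term Young convolution inequality with equal outer exponents, for normalised factors:
  the arithmetic-geometric mean inequality replaces \<open>\<phi>\<^sup>\<theta> \<psi>\<^sup>\<theta> \<kappa>\<^bsup>2 - 2\<theta>\<^esup>\<close> by a convex combination of the
  pairwise products, whose integrals are at most 1.\<close>

lemma nn_integral_trilinear_le_one:
  fixes \<phi> :: "'a \<Rightarrow> real" and \<psi> :: "'b \<Rightarrow> real" and \<kappa> :: "'a \<Rightarrow> 'b \<Rightarrow> real"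
  assumes "pair_sigma_finite M N"
    and [measurable]: "\<phi> \<in> borel_measurable M" "\<psi> \<in> borel_measurable N"
      "(\<lambda>z. \<kappa> (fst z) (snd z)) \<in> borel_measurable (M \<Otimes>\<^sub>M N)"
    and nn: "\<And>x. 0 \<le> \<phi> x" "\<And>y. 0 \<le> \<psi> y" "\<And>x y. 0 \<le> \<kappa> x y"
    and \<phi>: "(\<integral>\<^sup>+ x. ennreal (\<phi> x) \<partial>M) \<le> 1"
    and \<psi>: "(\<integral>\<^sup>+ y. ennreal (\<psi> y) \<partial>N) \<le> 1"
    and \<kappa>1: "\<And>x. (\<integral>\<^sup>+ y. ennreal (\<kappa> x y) \<partial>N) \<le> 1"
    and \<kappa>2: "\<And>y. (\<integral>\<^sup>+ x. ennreal (\<kappa> x y) \<partial>M) \<le> 1"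
    and \<theta>: "1 / 2 \<le> \<theta>" "\<theta> \<le> 1"
  shows "(\<integral>\<^sup>+ (x, y). ennreal (\<phi> x powr \<theta> * \<psi> y powr \<theta> * \<kappa> x y powr (2 - 2 * \<theta>)) \<partial>(M \<Otimes>\<^sub>M N)) \<le> 1"
proof -
  interpret pair_sigma_finite M N by fact
  let ?a = "ennreal (2 * \<theta> - 1)" and ?b = "ennreal (1 - \<theta>)"
  define F1 where "F1 z = ennreal (\<phi> (fst z)) * ennreal (\<psi> (snd z))" for z
  define F2 where "F2 z = ennreal (\<phi> (fst z)) * ennreal (\<kappa> (fst z) (snd z))" for z
  define F3 where "F3 z = ennreal (\<psi> (snd z)) * ennreal (\<kappa> (fst z) (snd z))" for z
  have m [measurable]: "F1 \<in> borel_measurable (M \<Otimes>\<^sub>M N)" "F2 \<in> borel_measurable (M \<Otimes>\<^sub>M N)"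
    "F3 \<in> borel_measurable (M \<Otimes>\<^sub>M N)"
    unfolding F1_def F2_def F3_def by measurable
  have [measurable]: "(\<lambda>y. \<kappa> x y) \<in> borel_measurable N" if "x \<in> space M" for x
    using measurable_Pair2[OF assms(4) that] by simp
  have [measurable]: "(\<lambda>x. \<kappa> x y) \<in> borel_measurable M" if "y \<in> space N" for y
    using measurable_Pair1[OF assms(4) that] by simp
  have 1: "integral\<^sup>N (M \<Otimes>\<^sub>M N) F1 \<le> 1"
  proof -
    have "integral\<^sup>N (M \<Otimes>\<^sub>M N) F1 = (\<integral>\<^sup>+ x. \<phi> x \<partial>M) * (\<integral>\<^sup>+ y. \<psi> y \<partial>N)"
      by (subst M2.nn_integral_fst[OF m(1), symmetric])
        (simp add: F1_def nn_integral_cmult nn_integral_multc)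
    also have "\<dots> \<le> 1 * 1" by (intro mult_mono \<phi> \<psi>) auto
    finally show ?thesis by simp
  qed
  have 2: "integral\<^sup>N (M \<Otimes>\<^sub>M N) F2 \<le> 1"
  proof -
    have "integral\<^sup>N (M \<Otimes>\<^sub>M N) F2 = (\<integral>\<^sup>+ x. \<phi> x * (\<integral>\<^sup>+ y. \<kappa> x y \<partial>N) \<partial>M)"
      by (subst M2.nn_integral_fst[OF m(2), symmetric])
        (auto simp: F2_def nn_integral_cmult intro!: nn_integral_cong)
    also have "\<dots> \<le> (\<integral>\<^sup>+ x. ennreal (\<phi> x) * 1 \<partial>M)"
      by (intro nn_integral_mono mult_left_mono \<kappa>1) auto
    finally show ?thesis using \<phi> by simp
  qed
  have 3: "integral\<^sup>N (M \<Otimes>\<^sub>M N) F3 \<le> 1"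
  proof -
    have "integral\<^sup>N (M \<Otimes>\<^sub>M N) F3 = (\<integral>\<^sup>+ y. \<psi> y * (\<integral>\<^sup>+ x. \<kappa> x y \<partial>M) \<partial>N)"
      by (subst nn_integral_snd[OF m(3), symmetric])
        (auto simp: F3_def nn_integral_cmult intro!: nn_integral_cong)
    also have "\<dots> \<le> (\<integral>\<^sup>+ y. ennreal (\<psi> y) * 1 \<partial>N)"
      by (intro nn_integral_mono mult_left_mono \<kappa>2) auto
    finally show ?thesis using \<psi> by simp
  qed
  have "ennreal (\<phi> x powr \<theta> * \<psi> y powr \<theta> * \<kappa> x y powr (2 - 2 * \<theta>))
      \<le> ?a * F1 (x, y) + (?b * F2 (x, y) + ?b * F3 (x, y))" for x y
  proof -
    let ?u = "\<phi> x * \<psi> y" and ?v = "\<phi> x * \<kappa> x y" and ?w = "\<psi> y * \<kappa> x y"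
    \<comment> \<open>The weights \<open>2 * \<theta> - 1\<close>, \<open>1 - \<theta>\<close>,
      \<open>1 - \<theta>\<close> sum to 1 and give the three factors their total exponents; the
      first is nonnegative because \<open>1 / 2 \<le> \<theta>\<close>.\<close>
    have "\<phi> x powr \<theta> * \<psi> y powr \<theta> * \<kappa> x y powr (2 - 2 * \<theta>)
        = ?u powr (2 * \<theta> - 1) * ?v powr (1 - \<theta>) * ?w powr (1 - \<theta>)"
    proof -
      have "a powr \<theta> = a powr (2 * \<theta> - 1) * a powr (1 - \<theta>)" for a :: real
        by (simp flip: powr_add)
      moreover have "a powr (2 - 2 * \<theta>) = a powr (1 - \<theta>) * a powr (1 - \<theta>)" for a :: real
        by (simp flip: powr_add)
      ultimately show ?thesis using nn by (simp add: powr_mult mult_ac)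
    qed
    also have "\<dots> \<le> (2 * \<theta> - 1) * ?u + (1 - \<theta>) * ?v + (1 - \<theta>) * ?w"
      using nn \<theta> by (intro weighted_am_gm3) auto
    finally have "ennreal (\<phi> x powr \<theta> * \<psi> y powr \<theta> * \<kappa> x y powr (2 - 2 * \<theta>))
      \<le> ennreal ((2 * \<theta> - 1) * ?u + ((1 - \<theta>) * ?v + (1 - \<theta>) * ?w))"
      by (simp add: ennreal_leI add_ac)
    also have "\<dots> = ?a * F1 (x, y) + (?b * F2 (x, y) + ?b * F3 (x, y))"
      using nn \<theta> by (simp add: F1_def F2_def F3_def ennreal_mult)
    finally show ?thesis .
  qed
  then have "(\<integral>\<^sup>+ (x, y). ennreal (\<phi> x powr \<theta> * \<psi> y powr \<theta> * \<kappa> x y powr (2 - 2 * \<theta>)) \<partial>(M \<Otimes>\<^sub>M N))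
      \<le> (\<integral>\<^sup>+ z. ?a * F1 z + (?b * F2 z + ?b * F3 z) \<partial>(M \<Otimes>\<^sub>M N))"
    by (intro nn_integral_mono) auto
  also have "\<dots> = ?a * integral\<^sup>N (M \<Otimes>\<^sub>M N) F1 + (?b * integral\<^sup>N (M \<Otimes>\<^sub>M N) F2
      + ?b * integral\<^sup>N (M \<Otimes>\<^sub>M N) F3)"
    by (simp add: nn_integral_add nn_integral_cmult)
  also have "\<dots> \<le> ?a * 1 + (?b * 1 + ?b * 1)"
    by (intro add_mono mult_left_mono 1 2 3) auto
  also have "\<dots> = 1" using \<theta> by (simp flip: ennreal_plus)
  finally show ?thesis .
qed

section \<open>Measurability, sigma-finiteness and translation on the half-plane\<close>

lemma half_plane_borel [measurable]: "half_plane \<in> sets borel"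
proof -
  have "open {x :: real \<times> real. 0 < snd x}" by (intro open_Collect_less continuous_intros)
  then show ?thesis by (simp add: half_plane_def)
qed

lemma half_plane_lebesgue [measurable]: "half_plane \<in> sets lebesgue"
  by (simp add: sets_completionI_sets)

lemma sigma_finite_half_plane: "sigma_finite_measure half_plane_measure"
proof (rule sigma_finite_measure_restrict_space)
  obtain A :: "(real \<times> real) set set"
    where "countable A" "A \<subseteq> sets lborel" "\<Union> A = space lborel" "\<forall>a\<in>A. emeasure lborel a \<noteq> \<infinity>"
    using lborel.sigma_finite_countable by blast
  then show "sigma_finite_measure (lebesgue :: (real \<times> real) measure)"
    by (intro sigma_finite_measure.intro exI[of _ A]) auto
qed simp

lemma pair_sigma_finite_half_plane: "pair_sigma_finite half_plane_measure half_plane_measure"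
  by (simp add: pair_sigma_finite_def sigma_finite_half_plane)

lemma one_less_enn2real: "1 < p \<Longrightarrow> p \<noteq> \<infinity> \<Longrightarrow> 1 < enn2real p"
  by (cases p) (auto simp: ennreal_less_iff simp flip: ennreal_1)

lemma borel_measurable_half_plane:
  "f \<in> borel_measurable borel \<Longrightarrow> f \<in> borel_measurable half_plane_measure"
  by (intro measurable_restrict_space1 measurable_completion) simp

text \<open>The factors carry the Lebesgue sigma-algebra, so the projections are composed with the
  identity into \<open>borel\<close>; Borel functions of \<open>x - y\<close> then become measurable
  on the product.\<close>

lemma measurable_half_plane_fst: "fst \<in> half_plane_measure \<Otimes>\<^sub>M half_plane_measure \<rightarrow>\<^sub>M (borel :: (real \<times> real) measure)"
  and measurable_half_plane_snd: "snd \<in> half_plane_measure \<Otimes>\<^sub>M half_plane_measure \<rightarrow>\<^sub>M (borel :: (real \<times> real) measure)"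
proof -
  have id: "(\<lambda>x. x) \<in> half_plane_measure \<rightarrow>\<^sub>M borel"
    by (intro borel_measurable_half_plane) simp
  show "fst \<in> half_plane_measure \<Otimes>\<^sub>M half_plane_measure \<rightarrow>\<^sub>M (borel :: (real \<times> real) measure)"
    using measurable_compose[OF measurable_fst[where ?M2.0 = half_plane_measure] id] by simp
  show "snd \<in> half_plane_measure \<Otimes>\<^sub>M half_plane_measure \<rightarrow>\<^sub>M (borel :: (real \<times> real) measure)"
    using measurable_compose[OF measurable_snd[where ?M1.0 = half_plane_measure] id] by simp
qed

lemma nn_integral_half_plane_le:
  assumes "f \<in> borel_measurable borel"
  shows "(\<integral>\<^sup>+ x. f x \<partial>half_plane_measure) \<le> (\<integral>\<^sup>+ x. f x \<partial>lborel)"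
proof -
  have "(\<integral>\<^sup>+ x. f x \<partial>half_plane_measure) = (\<integral>\<^sup>+ x. f x * indicator half_plane x \<partial>lebesgue)"
    by (subst nn_integral_restrict_space) auto
  also have "\<dots> \<le> (\<integral>\<^sup>+ x. f x \<partial>lebesgue)"
    by (intro nn_integral_mono) (auto simp: indicator_def)
  also have "\<dots> = (\<integral>\<^sup>+ x. f x \<partial>lborel)"
    using assms by (simp add: nn_integral_completion)
  finally show ?thesis .
qed

text \<open>The half-plane is not translation invariant, so the integral is first enlarged to the
  whole plane, where a translation changes nothing.\<close>

lemma nn_integral_half_plane_translate_le:
  fixes f :: "real \<times> real \<Rightarrow> ennreal"
  assumes [measurable]: "f \<in> borel_measurable borel"
  shows "(\<integral>\<^sup>+ x. f (x - y) \<partial>half_plane_measure) \<le> (\<integral>\<^sup>+ x. f x \<partial>lborel)"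
proof -
  have "(\<integral>\<^sup>+ x. f (x - y) \<partial>half_plane_measure) \<le> (\<integral>\<^sup>+ x. f (x - y) \<partial>lborel)"
    by (intro nn_integral_half_plane_le) measurable
  also have "\<dots> = (\<integral>\<^sup>+ x. f x \<partial>distr lborel borel ((+) (- y)))"
    by (subst nn_integral_distr) auto
  finally show ?thesis by (simp add: lborel_distr_plus)
qed

lemma borel_measurable_green:
  "(\<lambda>z. green (fst z) (snd z)) \<in> borel_measurable (half_plane_measure \<Otimes>\<^sub>M half_plane_measure)"
proof -
  have snd_borel: "snd \<in> borel_measurable (borel :: (real \<times> real) measure)"
    by (simp add: borel_prod[symmetric])
  note [measurable] = measurable_compose[OF measurable_half_plane_fst snd_borel]
    measurable_compose[OF measurable_half_plane_snd snd_borel]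
    borel_measurable_diff[OF measurable_half_plane_fst measurable_half_plane_snd]
  show ?thesis unfolding green_def by measurable
qed

section \<open>Interpolation between the weighted L1 bound and the Lp bound\<close>

text \<open>Upper bounds stand in for the two norms. They are strictly positive so that functions
  can be normalised by division; vanishing norms are reached later by a limit.\<close>

definition size_bounds :: "ennreal \<Rightarrow> real \<Rightarrow> real \<Rightarrow> (real \<times> real \<Rightarrow> real) \<Rightarrow> bool" where
  "size_bounds p A B \<omega> \<longleftrightarrow> 0 < A \<and> 0 < B \<and> \<omega> \<in> borel_measurable half_plane_measure \<and>
    (\<integral>\<^sup>+ x. ennreal \<bar>snd x * \<omega> x\<bar> \<partial>half_plane_measure) \<le> ennreal A \<and>
    (if p = \<infinity> then AE x in half_plane_measure. \<bar>\<omega> x\<bar> \<le> B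
     else (\<integral>\<^sup>+ x. ennreal (\<bar>\<omega> x\<bar> powr enn2real p) \<partial>half_plane_measure) \<le> ennreal (B powr enn2real p))"

text \<open>For \<open>p = \<infinity>\<close> the junk value \<open>1 / enn2real p = 0\<close> is the intended reciprocal.\<close>

lemma size_bounds_profile:
  assumes p: "1 < p" and sb: "size_bounds p A B \<omega>" and \<tau>: "0 < \<tau>" "\<tau> < 1"
    and \<theta>: "\<theta> = \<tau> + (1 - \<tau>) / enn2real p"
  shows "(\<integral>\<^sup>+ x. ennreal ((snd x powr \<tau> * \<bar>\<omega> x\<bar> / (A powr \<tau> * B powr (1 - \<tau>))) powr (1 / \<theta>))
    \<partial>half_plane_measure) \<le> 1"
proof -
  let ?M = half_plane_measure
  have AB: "0 < A" "0 < B" and [measurable]: "\<omega> \<in> borel_measurable ?M"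
    and L1: "(\<integral>\<^sup>+ x. ennreal \<bar>snd x * \<omega> x\<bar> \<partial>?M) \<le> ennreal A"
    using sb by (auto simp: size_bounds_def)
  have [measurable]: "snd \<in> borel_measurable ?M"
    by (intro borel_measurable_half_plane) (simp add: borel_prod[symmetric])
  have \<theta>0: "0 < \<theta>" using \<tau> \<theta> by (simp add: add_pos_nonneg)
  let ?u = "\<lambda>x. \<bar>snd x * \<omega> x\<bar> / A"
  have u: "(\<integral>\<^sup>+ x. ennreal (?u x) \<partial>?M) \<le> 1"
  proof -
    have "(\<integral>\<^sup>+ x. ennreal (?u x) \<partial>?M) = ennreal (1 / A) * (\<integral>\<^sup>+ x. ennreal \<bar>snd x * \<omega> x\<bar> \<partial>?M)"
      using AB by (subst nn_integral_cmult[symmetric]) (auto simp flip: ennreal_mult)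
    also have "\<dots> \<le> ennreal (1 / A) * ennreal A" by (intro mult_left_mono L1) auto
    also have "\<dots> = 1" using AB by (simp flip: ennreal_mult)
    finally show ?thesis .
  qed
  \<comment> \<open>The normalised profile is a product of powers of the weighted density
    \<open>?u\<close> and of \<open>\<bar>\<omega> x\<bar> / B\<close>, which are controlled by the
    L1 and the Lp hypothesis respectively.\<close>
  have eq: "(snd x powr \<tau> * \<bar>\<omega> x\<bar> / (A powr \<tau> * B powr (1 - \<tau>))) powr (1 / \<theta>)
      = ?u x powr (\<tau> / \<theta>) * (\<bar>\<omega> x\<bar> / B) powr ((1 - \<tau>) / \<theta>)" if "0 < snd x" for x
  proof -
    have "snd x powr \<tau> * \<bar>\<omega> x\<bar> / (A powr \<tau> * B powr (1 - \<tau>))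
        = ?u x powr \<tau> * (\<bar>\<omega> x\<bar> / B) powr (1 - \<tau>)"
    proof -
      have "\<bar>\<omega> x\<bar> = \<bar>\<omega> x\<bar> powr \<tau> * \<bar>\<omega> x\<bar> powr (1 - \<tau>)" by (simp flip: powr_add)
      then show ?thesis
        using that AB by (simp add: powr_divide powr_mult abs_mult)
    qed
    then show ?thesis using AB by (simp add: powr_mult powr_powr)
  qed
  show ?thesis
  proof (cases "p = \<infinity>")
    case True
    then have "AE x in ?M. \<bar>\<omega> x\<bar> \<le> B" using sb by (simp add: size_bounds_def)
    moreover have "\<theta> = \<tau>" using True \<theta> by simp
    \<comment> \<open>With \<open>\<theta> = \<tau>\<close> the exponent of \<open>?u\<close> is 1,
      and the power of \<open>\<bar>\<omega> x\<bar> / B\<close> is at most 1.\<close>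
    ultimately have "AE x in ?M. ennreal ((snd x powr \<tau> * \<bar>\<omega> x\<bar> / (A powr \<tau> * B powr (1 - \<tau>))) powr (1 / \<theta>))
        \<le> ennreal (?u x)"
    proof (elim AE_mp, intro AE_I2 impI ennreal_leI)
      fix x assume x: "x \<in> space ?M" and le: "\<bar>\<omega> x\<bar> \<le> B" and "\<theta> = \<tau>"
      have "0 < snd x" using x by (simp add: half_plane_def)
      moreover have "(\<bar>\<omega> x\<bar> / B) powr ((1 - \<tau>) / \<theta>) \<le> 1"
        using le AB \<tau> \<theta>0 by (intro powr_le1) auto
      then have "?u x powr 1 * (\<bar>\<omega> x\<bar> / B) powr ((1 - \<tau>) / \<theta>) \<le> ?u x * 1"
        using AB by (intro mult_mono) auto
      ultimately show "(snd x powr \<tau> * \<bar>\<omega> x\<bar> / (A powr \<tau> * B powr (1 - \<tau>))) powr (1 / \<theta>) \<le> ?u x"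
        using eq[of x] \<open>\<theta> = \<tau>\<close> \<tau> by simp
    qed
    then have "(\<integral>\<^sup>+ x. ennreal ((snd x powr \<tau> * \<bar>\<omega> x\<bar> / (A powr \<tau> * B powr (1 - \<tau>))) powr (1 / \<theta>)) \<partial>?M)
      \<le> (\<integral>\<^sup>+ x. ennreal (?u x) \<partial>?M)" by (rule nn_integral_mono_AE)
    also note u
    finally show ?thesis .
  next
    case False
    define P where "P = enn2real p"
    have P: "1 < P"
      using p False unfolding P_def by (rule one_less_enn2real)
    \<comment> \<open>These are the exponents of \<open>?u\<close> and \<open>?v\<close> in the
      profile; that they sum to 1 is precisely the definition of \<open>\<theta>\<close>.\<close>
    define a b where "a = \<tau> / \<theta>" and "b = (1 - \<tau>) / (P * \<theta>)"
    have ab: "0 \<le> a" "0 \<le> b" "a + b = 1"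
    proof -
      have "a + b = (\<tau> + (1 - \<tau>) / P) / \<theta>" by (simp add: a_def b_def add_divide_distrib)
      then show "a + b = 1" using \<theta>0 by (simp add: \<theta> P_def)
      show "0 \<le> a" "0 \<le> b" using \<tau> \<theta>0 P by (auto simp: a_def b_def)
    qed
    let ?v = "\<lambda>x. \<bar>\<omega> x\<bar> powr P / B powr P"
    have v: "(\<integral>\<^sup>+ x. ennreal (?v x) \<partial>?M) \<le> 1"
    proof -
      have "(\<integral>\<^sup>+ x. ennreal (?v x) \<partial>?M) = ennreal (1 / B powr P) * (\<integral>\<^sup>+ x. ennreal (\<bar>\<omega> x\<bar> powr P) \<partial>?M)"
        using AB by (subst nn_integral_cmult[symmetric]) (auto simp flip: ennreal_mult)
      also have "\<dots> \<le> ennreal (1 / B powr P) * ennreal (B powr P)"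
        using sb False by (intro mult_left_mono) (auto simp: size_bounds_def P_def)
      also have "\<dots> = 1" using AB by (simp flip: ennreal_mult)
      finally show ?thesis .
    qed
    have "(\<integral>\<^sup>+ x. ennreal ((snd x powr \<tau> * \<bar>\<omega> x\<bar> / (A powr \<tau> * B powr (1 - \<tau>))) powr (1 / \<theta>)) \<partial>?M)
      \<le> (\<integral>\<^sup>+ x. ennreal a * ennreal (?u x) + ennreal b * ennreal (?v x) \<partial>?M)"
    proof (rule nn_integral_mono)
      fix x assume "x \<in> space ?M"
      then have x: "0 < snd x" by (simp add: half_plane_def)
      have "?v x powr b = (\<bar>\<omega> x\<bar> / B) powr ((1 - \<tau>) / \<theta>)"
        using AB P by (simp add: powr_powr b_def flip: powr_divide)
      \<comment> \<open>The dummy factor \<open>1 powr 0\<close> fits a two-term mean into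
        \<open>weighted_am_gm3\<close>.\<close>
      then have "(snd x powr \<tau> * \<bar>\<omega> x\<bar> / (A powr \<tau> * B powr (1 - \<tau>))) powr (1 / \<theta>)
          = ?u x powr a * ?v x powr b * 1 powr 0"
        using eq[OF x] by (simp add: a_def)
      also have "\<dots> \<le> a * ?u x + b * ?v x + 0 * 1"
        using ab AB by (intro weighted_am_gm3) auto
      finally have "ennreal ((snd x powr \<tau> * \<bar>\<omega> x\<bar> / (A powr \<tau> * B powr (1 - \<tau>))) powr (1 / \<theta>))
        \<le> ennreal (a * ?u x + b * ?v x)" by (intro ennreal_leI) simp
      also have "\<dots> = ennreal a * ennreal (?u x) + ennreal b * ennreal (?v x)"
        using ab AB by (simp add: ennreal_mult ennreal_plus del: times_divide_eq_right)
      finally show "ennreal ((snd x powr \<tau> * \<bar>\<omega> x\<bar> / (A powr \<tau> * B powr (1 - \<tau>))) powr (1 / \<theta>))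
        \<le> ennreal a * ennreal (?u x) + ennreal b * ennreal (?v x)" .
    qed
    also have "\<dots> = ennreal a * (\<integral>\<^sup>+ x. ennreal (?u x) \<partial>?M) + ennreal b * (\<integral>\<^sup>+ x. ennreal (?v x) \<partial>?M)"
      by (simp add: nn_integral_add nn_integral_cmult)
    also have "\<dots> \<le> ennreal a * 1 + ennreal b * 1"
      by (intro add_mono mult_left_mono u v) auto
    also have "\<dots> = 1" using ab by (simp flip: ennreal_plus)
    finally show ?thesis .
  qed
qed

section \<open>The bilinear integral over a symmetric region of differences
  \<open>x - y\<close>\<close>

text \<open>After the pointwise bound \<open>green_le\<close>, both weighted functions and the power
  kernel are normalised so that \<open>nn_integral_trilinear_le_one\<close> applies. The symmetry of
  \<open>D\<close> makes the kernel's integral over \<open>y\<close> the same kind of quantity as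
  its integral over \<open>x\<close>.\<close>

lemma green_region_bound:
  assumes p: "1 < p" and \<omega>: "size_bounds p A B \<omega>" and \<eta>: "size_bounds p A' B' \<eta>"
    and \<tau>: "0 < \<tau>" "\<tau> < 1" and \<theta>: "\<theta> = \<tau> + (1 - \<tau>) / enn2real p" "1 / 2 \<le> \<theta>" "\<theta> < 1"
    and D [measurable]: "D \<in> sets borel" and D_sym: "\<And>z. - z \<in> D \<longleftrightarrow> z \<in> D"
    and k: "0 < k" "(\<integral>\<^sup>+ z. ennreal (norm z powr (- (\<tau> / (1 - \<theta>))) * indicator D z) \<partial>lborel) \<le> ennreal k"
  shows "(\<integral>\<^sup>+ (x, y). ennreal (green x y * \<bar>\<omega> x * \<eta> y\<bar> * indicator D (x - y))
      \<partial>(half_plane_measure \<Otimes>\<^sub>M half_plane_measure))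
    \<le> ennreal (1 / \<tau> * k powr (2 - 2 * \<theta>) * ((A * A') powr \<tau> * (B * B') powr (1 - \<tau>)))"
proof -
  let ?M = half_plane_measure
  have pos: "0 < A" "0 < B" "0 < A'" "0 < B'"
    and [measurable]: "\<omega> \<in> borel_measurable ?M" "\<eta> \<in> borel_measurable ?M"
    using \<omega> \<eta> by (auto simp: size_bounds_def)
  have [measurable]: "snd \<in> borel_measurable ?M"
    by (intro borel_measurable_half_plane) (simp add: borel_prod[symmetric])
  note [measurable] = measurable_half_plane_fst measurable_half_plane_snd
  define N N' where "N = A powr \<tau> * B powr (1 - \<tau>)" and "N' = A' powr \<tau> * B' powr (1 - \<tau>)"
  have N: "0 < N" "0 < N'" using pos by (auto simp: N_def N'_def)
  define \<phi> \<psi> where "\<phi> x = (snd x powr \<tau> * \<bar>\<omega> x\<bar> / N) powr (1 / \<theta>)"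
    and "\<psi> x = (snd x powr \<tau> * \<bar>\<eta> x\<bar> / N') powr (1 / \<theta>)" for x
  have \<theta>0: "0 < \<theta>" using \<theta>(2) by linarith
  \<comment> \<open>The exponent is chosen so that raising \<open>h\<close> to the power
    \<open>2 - 2 * \<theta>\<close> returns the decay \<open>- 2 * \<tau>\<close> of the kernel
    bound.\<close>
  define h where "h z = norm z powr (- (\<tau> / (1 - \<theta>))) * indicator D z / k" for z :: "real \<times> real"
  have h_meas [measurable]: "h \<in> borel_measurable borel" unfolding h_def by measurable
  have h_int: "(\<integral>\<^sup>+ z. ennreal (h z) \<partial>lborel) \<le> 1"
  proof -
    have "(\<integral>\<^sup>+ z. ennreal (h z) \<partial>lborel)
        = ennreal (1 / k) * (\<integral>\<^sup>+ z. ennreal (norm z powr (- (\<tau> / (1 - \<theta>))) * indicator D z) \<partial>lborel)"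
      using k by (subst nn_integral_cmult[symmetric]) (auto simp: h_def simp flip: ennreal_mult)
    also have "\<dots> \<le> ennreal (1 / k) * ennreal k" by (intro mult_left_mono k) auto
    also have "\<dots> = 1" using k by (simp flip: ennreal_mult)
    finally show ?thesis .
  qed
  have h_sym: "h (x - y) = h (y - x)" for x y
    using D_sym[of "x - y"] by (auto simp: h_def norm_minus_commute indicator_def)
  \<comment> \<open>The constant undoes the three normalisations and carries the factor
    \<open>1 / \<tau>\<close> from \<open>green_le\<close>.\<close>
  let ?c = "1 / \<tau> * k powr (2 - 2 * \<theta>) * (N * N')"
  let ?F = "\<lambda>x y. \<phi> x powr \<theta> * \<psi> y powr \<theta> * h (x - y) powr (2 - 2 * \<theta>)"
  have F: "(\<integral>\<^sup>+ (x, y). ennreal (?F x y) \<partial>(?M \<Otimes>\<^sub>M ?M)) \<le> 1"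
  proof (rule nn_integral_trilinear_le_one)
    show "(\<integral>\<^sup>+ x. ennreal (\<phi> x) \<partial>?M) \<le> 1" "(\<integral>\<^sup>+ x. ennreal (\<psi> x) \<partial>?M) \<le> 1"
      unfolding \<phi>_def \<psi>_def N_def N'_def
      using size_bounds_profile[OF p \<omega> \<tau> \<theta>(1)] size_bounds_profile[OF p \<eta> \<tau> \<theta>(1)] by auto
    show "(\<integral>\<^sup>+ x. ennreal (h (x - y)) \<partial>?M) \<le> 1" for y
      using nn_integral_half_plane_translate_le[of "\<lambda>z. ennreal (h z)" y] h_int by auto
    then show "(\<integral>\<^sup>+ y. ennreal (h (x - y)) \<partial>?M) \<le> 1" for x
      by (subst h_sym)
    show "\<phi> \<in> borel_measurable ?M" "\<psi> \<in> borel_measurable ?M" unfolding \<phi>_def \<psi>_def by measurable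
    show "(\<lambda>z. h (fst z - snd z)) \<in> borel_measurable (?M \<Otimes>\<^sub>M ?M)" by measurable
  qed (use k \<theta> in \<open>auto simp: \<phi>_def \<psi>_def h_def pair_sigma_finite_half_plane\<close>)
  have "(\<integral>\<^sup>+ (x, y). ennreal (green x y * \<bar>\<omega> x * \<eta> y\<bar> * indicator D (x - y)) \<partial>(?M \<Otimes>\<^sub>M ?M))
      \<le> (\<integral>\<^sup>+ (x, y). ennreal ?c * ennreal (?F x y) \<partial>(?M \<Otimes>\<^sub>M ?M))"
  proof (intro nn_integral_mono, clarify)
    fix a b c d :: real
    assume "((a, b), (c, d)) \<in> space (?M \<Otimes>\<^sub>M ?M)"
    moreover define x y where "x = (a, b)" and "y = (c, d)"
    ultimately have x: "0 < snd x" "0 < snd y" by (auto simp: space_pair_measure half_plane_def)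
    have "green x y * \<bar>\<omega> x * \<eta> y\<bar> * indicator D (x - y) \<le> ?c * ?F x y"
    proof (cases "x - y \<in> D")
      case False
      then show ?thesis using \<tau> k N by (auto simp: \<theta> h_def)
    next
      case True
      have e: "\<tau> * (2 - 2 * \<theta>) / (1 - \<theta>) = 2 * \<tau>"
        using \<theta>(3) by (simp add: field_simps)
      have "h (x - y) powr (2 - 2 * \<theta>) = norm (x - y) powr (- 2 * \<tau>) / k powr (2 - 2 * \<theta>)"
        using True k by (simp add: h_def powr_divide powr_powr e)
      moreover have "\<phi> x powr \<theta> = snd x powr \<tau> * \<bar>\<omega> x\<bar> / N" "\<psi> y powr \<theta> = snd y powr \<tau> * \<bar>\<eta> y\<bar> / N'"
        using N \<theta>0 by (auto simp: \<phi>_def \<psi>_def powr_powr)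
      ultimately have eq: "?c * ?F x y = 1 / \<tau> * (snd x powr \<tau> * snd y powr \<tau> * norm (x - y) powr (- 2 * \<tau>)) * \<bar>\<omega> x * \<eta> y\<bar>"
        using N k by (simp add: abs_mult)
      have "green x y * \<bar>\<omega> x * \<eta> y\<bar> \<le> ?c * ?F x y"
        unfolding eq using x \<tau> by (intro mult_right_mono green_le) auto
      then show ?thesis using True by simp
    qed
    then show "ennreal (green (a, b) (c, d) * \<bar>\<omega> (a, b) * \<eta> (c, d)\<bar> * indicator D ((a, b) - (c, d)))
      \<le> ennreal ?c * ennreal (?F (a, b) (c, d))"
      using \<tau> N by (subst ennreal_mult[symmetric]) (auto simp: x_def y_def intro: ennreal_leI)
  qed
  also have "\<dots> = ennreal ?c * (\<integral>\<^sup>+ (x, y). ennreal (?F x y) \<partial>(?M \<Otimes>\<^sub>M ?M))"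
    unfolding split_beta \<phi>_def \<psi>_def by (intro nn_integral_cmult) measurable
  also have "\<dots> \<le> ennreal ?c * 1" by (intro mult_left_mono F) auto
  finally show ?thesis using pos by (simp add: N_def N'_def powr_mult mult_ac)
qed

text \<open>Choosing the cutoff radius as this power of \<open>P / Q\<close> turns the bound for every admissible \<open>\<tau>\<close>
  into the same expression \<open>P\<^sup>s Q\<^bsup>1 - s\<^esup>\<close>.\<close>

lemma green_region_bound_scaled:
  assumes p: "1 < p" and \<omega>: "size_bounds p A B \<omega>" and \<eta>: "size_bounds p A' B' \<eta>"
    and P: "P = A * A'" and Q: "Q = B * B'"
    and \<tau>: "0 < \<tau>" "\<tau> < 1" and \<theta>: "\<theta> = \<tau> + (1 - \<tau>) / enn2real p" "1 / 2 \<le> \<theta>" "\<theta> < 1"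
    and m: "m = 6 - 4 / enn2real p" "0 < m" and s: "s * m = 4 * (1 - 1 / enn2real p)"
    and R_eq: "R = (P / Q) powr (1 / m)"
    and D: "D \<in> sets borel" and D_sym: "\<And>z. - z \<in> D \<longleftrightarrow> z \<in> D"
    and c: "0 < c" "(\<integral>\<^sup>+ z. ennreal (norm z powr (- (\<tau> / (1 - \<theta>))) * indicator D z) \<partial>lborel)
      \<le> ennreal (c * R powr (2 - \<tau> / (1 - \<theta>)))"
  shows "(\<integral>\<^sup>+ (x, y). ennreal (green x y * \<bar>\<omega> x * \<eta> y\<bar> * indicator D (x - y))
      \<partial>(half_plane_measure \<Otimes>\<^sub>M half_plane_measure))
    \<le> ennreal (1 / \<tau> * c powr (2 - 2 * \<theta>) * (P powr s * Q powr (1 - s)))"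
proof -
  have pos: "0 < P" "0 < Q" using \<omega> \<eta> by (auto simp: size_bounds_def P Q)
  then have R: "0 < R" by (simp add: R_eq)
  \<comment> \<open>This is the exponent of \<open>R\<close> in the final bound. It equals
    \<open>m * (s - \<tau>)\<close>, so with \<open>R\<close> the \<open>m\<close>-th root of
    \<open>P / Q\<close> it contributes \<open>(P / Q) powr (s - \<tau>)\<close>, which replaces
    \<open>\<tau>\<close> by \<open>s\<close> in the powers of \<open>P\<close> and
    \<open>Q\<close>.\<close>
  have "(2 - \<tau> / (1 - \<theta>)) * (2 - 2 * \<theta>) = 4 * (1 - \<theta>) - 2 * \<tau>"
    using \<theta>(3) by (simp add: field_simps)
  also have "\<dots> = 4 * (1 - 1 / enn2real p) - \<tau> * m"
    by (simp add: \<theta>(1) m(1) algebra_simps diff_divide_distrib)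
  also have "\<dots> = m * (s - \<tau>)" using s by (simp add: algebra_simps)
  finally have e: "(2 - \<tau> / (1 - \<theta>)) * (2 - 2 * \<theta>) = m * (s - \<tau>)" .
  have "(c * R powr (2 - \<tau> / (1 - \<theta>))) powr (2 - 2 * \<theta>) = c powr (2 - 2 * \<theta>) * R powr (m * (s - \<tau>))"
    using c R by (simp add: powr_mult powr_powr e)
  also have "R powr (m * (s - \<tau>)) = P powr (s - \<tau>) * Q powr (\<tau> - s)"
    using pos m(2) powr_minus_divide[of Q "s - \<tau>"] by (simp add: R_eq powr_powr powr_divide)
  finally have k: "(c * R powr (2 - \<tau> / (1 - \<theta>))) powr (2 - 2 * \<theta>) * (P powr \<tau> * Q powr (1 - \<tau>))
    = c powr (2 - 2 * \<theta>) * ((P powr (s - \<tau>) * P powr \<tau>) * (Q powr (\<tau> - s) * Q powr (1 - \<tau>)))"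
    by simp
  have "(c * R powr (2 - \<tau> / (1 - \<theta>))) powr (2 - 2 * \<theta>) * (P powr \<tau> * Q powr (1 - \<tau>))
    = c powr (2 - 2 * \<theta>) * (P powr s * Q powr (1 - s))"
    unfolding k by (simp flip: powr_add)
  moreover have "0 < c * R powr (2 - \<tau> / (1 - \<theta>))" using c R by simp
  ultimately show ?thesis
    using green_region_bound[OF p \<omega> \<eta> \<tau> \<theta> D D_sym _ c(2)]
    by (simp add: P Q mult.assoc)
qed

section \<open>Arithmetic of the exponents and the choice of \<open>\<tau>\<close> on each
  region\<close>

text \<open>Numerator and denominator are divided by the exponent. At infinity
  \<open>enn2real\<close> is 0 and division by it gives 0, so a single formula covers all
  cases.\<close>

lemma exponent_alt:
  assumes "1 < p"
  shows "exponent a b p = (a - b / enn2real p) / (3 - 2 / enn2real p)"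
proof (cases "p = \<infinity>")
  case False
  then have "1 < enn2real p"
    using assms by (intro one_less_enn2real)
  then have "a - b / enn2real p = (a * enn2real p - b) / enn2real p"
    "3 - 2 / enn2real p = (3 * enn2real p - 2) / enn2real p"
    by (simp_all add: diff_divide_distrib)
  then show ?thesis using False \<open>1 < enn2real p\<close> by (simp add: exponent_def)
qed (simp add: exponent_def)

lemma reciprocal_exponent_bounds:
  assumes "1 < p"
  shows "0 \<le> 1 / enn2real p" "1 / enn2real p < 1"
proof -
  show "1 / enn2real p < 1"
  proof (cases "p = \<infinity>")
    case False
    then have "1 < enn2real p" using assms by (intro one_less_enn2real)
    then show ?thesis by simp
  qed simp
qed simp

text \<open>The near and far regions contribute \<open>K1\<close> and \<open>K2\<close> times the
  same expression \<open>T\<close>. Both constants depend on \<open>p\<close> alone, since the two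
  values of \<open>\<tau>\<close> are fixed multiples of \<open>s\<close>; only the radius depends
  on the functions.\<close>

lemma green_bilinear_size_bounds:
  assumes p: "1 < p"
  shows "\<exists>C>0. \<forall>A B A' B' \<omega> \<eta>. size_bounds p A B \<omega> \<longrightarrow> size_bounds p A' B' \<eta> \<longrightarrow>
    (\<integral>\<^sup>+ (x, y). ennreal (green x y * \<bar>\<omega> x * \<eta> y\<bar>) \<partial>(half_plane_measure \<Otimes>\<^sub>M half_plane_measure))
    \<le> ennreal (C * ((A * A') powr exponent 2 2 p * (B * B') powr exponent 1 0 p))"
proof -
  let ?M = half_plane_measure
  define \<iota> where "\<iota> = 1 / enn2real p"
  have \<iota>: "0 \<le> \<iota>" "\<iota> < 1" using reciprocal_exponent_bounds[OF p] by (auto simp: \<iota>_def)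
  define s where "s = exponent 2 2 p"
  have s_eq: "s = (2 - 2 * \<iota>) / (3 - 2 * \<iota>)" by (simp add: s_def exponent_alt[OF p] \<iota>_def)
  have s: "0 < s" "s \<le> 2 / 3" using \<iota> by (auto simp: s_eq field_simps)
  have s1: "exponent 1 0 p = 1 - s"
  proof -
    have "exponent 1 0 p = 1 / (3 - 2 * \<iota>)" by (simp add: exponent_alt[OF p] \<iota>_def)
    then show ?thesis using \<iota> by (simp add: s_eq field_simps)
  qed
  define m where "m = 6 - 4 * \<iota>"
  have m: "0 < m" using \<iota> by (simp add: m_def)
  have sm: "s * m = 4 * (1 - \<iota>)" using \<iota> by (simp add: s_eq m_def field_simps)
  define \<theta> where "\<theta> \<tau> = \<tau> + (1 - \<tau>) * \<iota>" for \<tau>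
  define d where "d \<tau> = \<tau> / (1 - \<theta> \<tau>)" for \<tau>
  have \<theta>1: "1 - \<theta> \<tau> = (1 - \<iota>) * (1 - \<tau>)" for \<tau> by (simp add: \<theta>_def algebra_simps)
  \<comment> \<open>Criticality of \<open>\<tau> = s\<close>: this identity says
    \<open>d s = 2\<close>, the dimension, where the power kernel is borderline both at 0 and at
    infinity.\<close>
  have \<theta>s: "\<theta> s = 1 - s / 2"
    using \<iota> by (simp add: s_eq \<theta>_def divide_simps) (simp add: algebra_simps)
  \<comment> \<open>One value on each side of the critical \<open>s\<close>;
    \<open>s \<le> 2 / 3\<close> keeps \<open>\<tau>2\<close> at most 5 / 6.\<close>
  define \<tau>1 \<tau>2 where "\<tau>1 = 3 / 4 * s" and "\<tau>2 = 5 / 4 * s"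
  have \<tau>: "0 < \<tau>1" "\<tau>1 < 1" "0 < \<tau>2" "\<tau>2 < 1" using s by (auto simp: \<tau>1_def \<tau>2_def)
  have \<theta>lt: "\<theta> \<tau>1 < 1" "\<theta> \<tau>2 < 1"
    using \<theta>1[of \<tau>1] \<theta>1[of \<tau>2] \<tau> \<iota> by (smt (verit) mult_pos_pos)+
  \<comment> \<open>The bound is tight: for \<open>p = \<infinity>\<close> one has
    \<open>s = 2 / 3\<close> and \<open>\<theta> \<tau>1\<close> is exactly 1 / 2, so the factor 3 /
    4 cannot be lowered uniformly in \<open>p\<close>.\<close>
  have \<theta>ge: "1 / 2 \<le> \<theta> \<tau>1" "1 / 2 \<le> \<theta> \<tau>2"
  proof -
    have "\<theta> \<tau>1 = \<theta> s - s / 4 * (1 - \<iota>)" by (simp add: \<theta>_def \<tau>1_def field_simps)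
    moreover have "s / 4 * (1 - \<iota>) \<le> s / 4" using s \<iota> by (simp add: mult_le_cancel_left1)
    ultimately show "1 / 2 \<le> \<theta> \<tau>1" using \<theta>s s by linarith
    have "\<theta> \<tau>2 = \<theta> s + s / 4 * (1 - \<iota>)" by (simp add: \<theta>_def \<tau>2_def field_simps)
    moreover have "0 \<le> s / 4 * (1 - \<iota>)" using s \<iota> by simp
    ultimately show "1 / 2 \<le> \<theta> \<tau>2" using \<theta>s s by linarith
  qed
  \<comment> \<open>The sign of \<open>s - \<tau>\<close> decides whether \<open>d \<tau>\<close> is
    below or above 2, that is, on which side the kernel is integrable.\<close>
  have gap: "2 * (1 - \<theta> \<tau>) - \<tau> = m / 2 * (s - \<tau>)" for \<tau>
    using sm by (simp add: \<theta>1 m_def algebra_simps)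
  have d: "0 \<le> d \<tau>1" "d \<tau>1 < 2" "2 < d \<tau>2"
  proof -
    have "0 < m / 2 * (s - \<tau>1)" using m s by (simp add: \<tau>1_def)
    then show "d \<tau>1 < 2" using gap[of \<tau>1] \<theta>lt by (simp add: d_def divide_less_eq)
    have "m / 2 * (s - \<tau>2) < 0" using m s by (simp add: \<tau>2_def mult_less_0_iff)
    then show "2 < d \<tau>2" using gap[of \<tau>2] \<theta>lt by (simp add: d_def less_divide_eq)
    show "0 \<le> d \<tau>1" using \<theta>lt \<tau> by (simp add: d_def)
  qed
  define c1 c2 where "c1 = (2 / (1 - d \<tau>1 / 2))\<^sup>2" and "c2 = (2 + 2 / (d \<tau>2 / 2 - 1))\<^sup>2"
  have c: "0 < c1" "0 < c2"
  proof -
    show "0 < c1" using d by (simp add: c1_def)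
    have "0 < 2 / (d \<tau>2 / 2 - 1)" using d by simp
    then have "0 < 2 + 2 / (d \<tau>2 / 2 - 1)" by linarith
    then show "0 < c2" unfolding c2_def by (rule zero_less_power)
  qed
  define K1 K2 where "K1 = 1 / \<tau>1 * c1 powr (2 - 2 * \<theta> \<tau>1)" and "K2 = 1 / \<tau>2 * c2 powr (2 - 2 * \<theta> \<tau>2)"
  have K: "0 < K1" "0 < K2" using c \<tau> by (auto simp: K1_def K2_def)
  show ?thesis
  proof (intro exI[of _ "K1 + K2"] conjI allI impI)
    show "0 < K1 + K2" using K by simp
    fix A B A' B' \<omega> \<eta> assume \<omega>: "size_bounds p A B \<omega>" and \<eta>: "size_bounds p A' B' \<eta>"
    have [measurable]: "\<omega> \<in> borel_measurable ?M" "\<eta> \<in> borel_measurable ?M"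
      using \<omega> \<eta> by (auto simp: size_bounds_def)
    define R where "R = (A * A' / (B * B')) powr (1 / m)"
    have R: "0 < R" using \<omega> \<eta> by (simp add: R_def size_bounds_def)
    define D where "D = {z :: real \<times> real. norm z < R}"
    have D [measurable]: "D \<in> sets borel" unfolding D_def by measurable
    define T where "T = (A * A') powr s * (B * B') powr (1 - s)"
    have T: "0 \<le> T" by (simp add: T_def)
    let ?f = "\<lambda>E (x, y). ennreal (green x y * \<bar>\<omega> x * \<eta> y\<bar> * indicator E (x - y))"
    note [measurable] = measurable_half_plane_fst measurable_half_plane_snd borel_measurable_green
    have meas: "?f E \<in> borel_measurable (?M \<Otimes>\<^sub>M ?M)" if [measurable]: "E \<in> sets borel" for E
      unfolding split_beta by measurable
    note scaled = green_region_bound_scaled[OF p \<omega> \<eta> refl refl, where s = s and m = m and R = R, folded T_def]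
    have near: "integral\<^sup>N (?M \<Otimes>\<^sub>M ?M) (?f D) \<le> ennreal (K1 * T)"
      unfolding K1_def
    proof (rule scaled)
      show "(\<integral>\<^sup>+ z. ennreal (norm z powr (- (\<tau>1 / (1 - \<theta> \<tau>1))) * indicator D z) \<partial>lborel)
        \<le> ennreal (c1 * R powr (2 - \<tau>1 / (1 - \<theta> \<tau>1)))"
        using nn_integral_norm_powr_near[OF d(1,2) R] by (simp only: d_def D_def c1_def)
    qed (use \<tau> \<theta>ge \<theta>lt m sm c D in \<open>simp_all add: \<theta>_def \<iota>_def m_def R_def D_def\<close>)
    have far: "integral\<^sup>N (?M \<Otimes>\<^sub>M ?M) (?f (- D)) \<le> ennreal (K2 * T)"
      unfolding K2_def
    proof (rule scaled)
      show "(\<integral>\<^sup>+ z. ennreal (norm z powr (- (\<tau>2 / (1 - \<theta> \<tau>2))) * indicator (- D) z) \<partial>lborel)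
        \<le> ennreal (c2 * R powr (2 - \<tau>2 / (1 - \<theta> \<tau>2)))"
        using nn_integral_norm_powr_far[OF d(3) R] by (simp only: d_def D_def c2_def)
    qed (use \<tau> \<theta>ge \<theta>lt m sm c D in \<open>simp_all add: \<theta>_def \<iota>_def m_def R_def D_def\<close>)
    have "(\<integral>\<^sup>+ (x, y). ennreal (green x y * \<bar>\<omega> x * \<eta> y\<bar>) \<partial>(?M \<Otimes>\<^sub>M ?M))
      = (\<integral>\<^sup>+ z. ?f D z + ?f (- D) z \<partial>(?M \<Otimes>\<^sub>M ?M))"
      by (intro nn_integral_cong) (auto simp: indicator_def)
    also have "\<dots> = integral\<^sup>N (?M \<Otimes>\<^sub>M ?M) (?f D) + integral\<^sup>N (?M \<Otimes>\<^sub>M ?M) (?f (- D))"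
      using D by (intro nn_integral_add meas) auto
    also have "\<dots> \<le> ennreal (K1 * T) + ennreal (K2 * T)" by (intro add_mono near far)
    also have "\<dots> = ennreal ((K1 + K2) * T)" using K T by (simp add: algebra_simps flip: ennreal_plus)
    finally show "(\<integral>\<^sup>+ (x, y). ennreal (green x y * \<bar>\<omega> x * \<eta> y\<bar>) \<partial>(?M \<Otimes>\<^sub>M ?M))
      \<le> ennreal ((K1 + K2) * ((A * A') powr exponent 2 2 p * (B * B') powr exponent 1 0 p))"
      by (simp add: T_def s1 flip: s_def)
  qed
qed

section \<open>Passage from positive bounds to the norms themselves\<close>

lemma Lp_norm_nonneg: "0 \<le> Lp_norm M p f"
  by (simp add: Lp_norm_def)

text \<open>The added \<open>e\<close> makes both bounds positive even when a norm is 0, as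
  \<open>size_bounds\<close> demands.\<close>

lemma size_bounds_Lp_norm:
  assumes p: "1 < p" and \<omega>: "\<omega> \<in> Lp_space half_plane_measure p"
    and x\<omega>: "(\<lambda>x. snd x * \<omega> x) \<in> Lp_space half_plane_measure 1" and e: "0 < e"
  shows "size_bounds p (Lp_norm half_plane_measure 1 (\<lambda>x. snd x * \<omega> x) + e)
    (Lp_norm half_plane_measure p \<omega> + e) \<omega>"
proof -
  let ?M = half_plane_measure
  have pos: "0 < Lp_norm ?M q f + e" for q f using Lp_norm_nonneg[of ?M q f] e by linarith
  have m: "\<omega> \<in> borel_measurable ?M" using \<omega> by (simp add: Lp_space_def)
  have int: "integrable ?M (\<lambda>x. \<bar>snd x * \<omega> x\<bar>)"
    using x\<omega> by (simp add: Lp_space_def)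
  have "(\<integral>\<^sup>+ x. ennreal \<bar>snd x * \<omega> x\<bar> \<partial>?M) = ennreal (LINT x|?M. \<bar>snd x * \<omega> x\<bar>)"
    using int by (intro nn_integral_eq_integral) auto
  also have "\<dots> \<le> ennreal (Lp_norm ?M 1 (\<lambda>x. snd x * \<omega> x) + e)"
    using e by (intro ennreal_leI) (simp add: Lp_norm_def)
  finally have 1: "(\<integral>\<^sup>+ x. ennreal \<bar>snd x * \<omega> x\<bar> \<partial>?M) \<le> ennreal (Lp_norm ?M 1 (\<lambda>x. snd x * \<omega> x) + e)" .
  have 2: "if p = \<infinity> then AE x in ?M. \<bar>\<omega> x\<bar> \<le> Lp_norm ?M p \<omega> + e
     else (\<integral>\<^sup>+ x. ennreal (\<bar>\<omega> x\<bar> powr enn2real p) \<partial>?M) \<le> ennreal ((Lp_norm ?M p \<omega> + e) powr enn2real p)"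
  proof (cases "p = \<infinity>")
    case True
    let ?S = "esssup ?M (\<lambda>x. ennreal \<bar>\<omega> x\<bar>)"
    have S: "?S = ennreal (enn2real ?S)" using \<omega> True by (simp add: Lp_space_def)
    have "AE x in ?M. \<bar>\<omega> x\<bar> \<le> Lp_norm ?M p \<omega> + e"
      using esssup_AE[of "\<lambda>x. ennreal \<bar>\<omega> x\<bar>" ?M]
    proof (rule eventually_mono)
      fix x assume "ennreal \<bar>\<omega> x\<bar> \<le> ?S"
      then have "\<bar>\<omega> x\<bar> \<le> enn2real ?S" using S by (metis ennreal_le_iff enn2real_nonneg)
      then show "\<bar>\<omega> x\<bar> \<le> Lp_norm ?M p \<omega> + e" using True e by (simp add: Lp_norm_def)
    qed
    then show ?thesis using True by simp
  next
    case False
    define P where "P = enn2real p"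
    have P: "0 < P" using one_less_enn2real[OF p False] by (simp add: P_def)
    let ?I = "LINT x|?M. \<bar>\<omega> x\<bar> powr P"
    have "(\<integral>\<^sup>+ x. ennreal (\<bar>\<omega> x\<bar> powr P) \<partial>?M) = ennreal ?I"
      using \<omega> False by (intro nn_integral_eq_integral) (auto simp: Lp_space_def P_def)
    also have "?I = (?I powr (1 / P)) powr P" using P by (simp add: powr_powr)
    also have "\<dots> \<le> (?I powr (1 / P) + e) powr P" using P e by (intro powr_mono2) auto
    finally show ?thesis using False by (simp add: Lp_norm_def P_def ennreal_leI)
  qed
  show ?thesis unfolding size_bounds_def using pos m 1 2 by blast
qed

lemma green_bilinear_bound:
  assumes p: "1 < p"
  obtains C where "0 < C"
    and "\<And>\<omega> \<eta>. \<omega> \<in> Lp_space half_plane_measure p \<Longrightarrow> \<eta> \<in> Lp_space half_plane_measure p \<Longrightarrow>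
      (\<lambda>x. snd x * \<omega> x) \<in> Lp_space half_plane_measure 1 \<Longrightarrow>
      (\<lambda>x. snd x * \<eta> x) \<in> Lp_space half_plane_measure 1 \<Longrightarrow>
      (\<integral>\<^sup>+ (x, y). ennreal (green x y * \<bar>\<omega> x * \<eta> y\<bar>) \<partial>(half_plane_measure \<Otimes>\<^sub>M half_plane_measure))
      \<le> ennreal (C
        * Lp_norm half_plane_measure 1 (\<lambda>x. snd x * \<omega> x) powr exponent 2 2 p
        * Lp_norm half_plane_measure p \<omega> powr exponent 1 0 p
        * Lp_norm half_plane_measure 1 (\<lambda>x. snd x * \<eta> x) powr exponent 2 2 p
        * Lp_norm half_plane_measure p \<eta> powr exponent 1 0 p)"
proof -
  let ?M = half_plane_measure
  obtain C where C: "0 < C" and bound: "\<And>A B A' B' \<omega> \<eta>. size_bounds p A B \<omega> \<Longrightarrow> size_bounds p A' B' \<eta> \<Longrightarrow>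
    (\<integral>\<^sup>+ (x, y). ennreal (green x y * \<bar>\<omega> x * \<eta> y\<bar>) \<partial>(?M \<Otimes>\<^sub>M ?M))
    \<le> ennreal (C * ((A * A') powr exponent 2 2 p * (B * B') powr exponent 1 0 p))"
    using green_bilinear_size_bounds[OF p] by blast
  \<comment> \<open>Positive exponents make the powers continuous down to base 0, which the limit
    below uses.\<close>
  have ex: "0 < exponent 2 2 p" "0 < exponent 1 0 p"
    using reciprocal_exponent_bounds[OF p] by (auto simp: exponent_alt[OF p] intro!: divide_pos_pos)
  show thesis
  proof (rule that[OF C])
    fix \<omega> \<eta>
    assume \<omega>: "\<omega> \<in> Lp_space ?M p" "(\<lambda>x. snd x * \<omega> x) \<in> Lp_space ?M 1"
      and \<eta>: "\<eta> \<in> Lp_space ?M p" "(\<lambda>x. snd x * \<eta> x) \<in> Lp_space ?M 1"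
    define a b a' b' where "a = Lp_norm ?M 1 (\<lambda>x. snd x * \<omega> x)" and "b = Lp_norm ?M p \<omega>"
      and "a' = Lp_norm ?M 1 (\<lambda>x. snd x * \<eta> x)" and "b' = Lp_norm ?M p \<eta>"
    have nn: "0 \<le> a" "0 \<le> b" "0 \<le> a'" "0 \<le> b'"
      by (auto simp: a_def b_def a'_def b'_def Lp_norm_nonneg)
    let ?g = "\<lambda>e. C * (((a + e) * (a' + e)) powr exponent 2 2 p * ((b + e) * (b' + e)) powr exponent 1 0 p)"
    \<comment> \<open>\<open>size_bounds\<close> requires positive bounds; letting \<open>e\<close> tend to 0 covers vanishing norms.\<close>
    have "(?g \<longlongrightarrow> ?g 0) (at_right 0)"
      using nn ex
      by (intro tendsto_intros tendsto_powr2) (auto intro!: eventually_at_rightI[of 0 1])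
    then have "((\<lambda>e. ennreal (?g e)) \<longlongrightarrow> ennreal (?g 0)) (at_right 0)"
      by (rule tendsto_ennrealI)
    moreover have "\<forall>\<^sub>F e in at_right 0. (\<integral>\<^sup>+ (x, y). ennreal (green x y * \<bar>\<omega> x * \<eta> y\<bar>) \<partial>(?M \<Otimes>\<^sub>M ?M)) \<le> ennreal (?g e)"
      using bound[OF size_bounds_Lp_norm[OF p \<omega>] size_bounds_Lp_norm[OF p \<eta>]]
      by (auto simp: a_def b_def a'_def b'_def intro!: eventually_at_rightI[of 0 1])
    ultimately have "(\<integral>\<^sup>+ (x, y). ennreal (green x y * \<bar>\<omega> x * \<eta> y\<bar>) \<partial>(?M \<Otimes>\<^sub>M ?M)) \<le> ennreal (?g 0)"
      by (rule tendsto_lowerbound) simp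
    also have "?g 0 = C * a powr exponent 2 2 p * b powr exponent 1 0 p * a' powr exponent 2 2 p * b' powr exponent 1 0 p"
      using nn by (simp add: powr_mult)
    finally show "(\<integral>\<^sup>+ (x, y). ennreal (green x y * \<bar>\<omega> x * \<eta> y\<bar>) \<partial>(?M \<Otimes>\<^sub>M ?M))
      \<le> ennreal (C * Lp_norm ?M 1 (\<lambda>x. snd x * \<omega> x) powr exponent 2 2 p * Lp_norm ?M p \<omega> powr exponent 1 0 p
        * Lp_norm ?M 1 (\<lambda>x. snd x * \<eta> x) powr exponent 2 2 p * Lp_norm ?M p \<eta> powr exponent 1 0 p)"
      by (simp add: a_def b_def a'_def b'_def)
  qed
qed

section \<open>Linear structure of the function spaces and the symmetric Green form\<close>

lemma Lp_space_uminus: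
  assumes "f \<in> Lp_space M p" shows "(\<lambda>x. - f x) \<in> Lp_space M p"
  using assms by (auto simp: Lp_space_def)

text \<open>Needed to apply the bilinear bound to sums and differences. For finite \<open>p\<close>
  the sum is at most twice the larger absolute value, whose power is at most the sum of the two
  powers; for \<open>p = \<infinity>\<close> the essential suprema add.\<close>

lemma Lp_space_add:
  assumes f: "f \<in> Lp_space M p" and g: "g \<in> Lp_space M p"
  shows "(\<lambda>x. f x + g x) \<in> Lp_space M p"
proof -
  have [measurable]: "f \<in> borel_measurable M" "g \<in> borel_measurable M"
    using f g by (auto simp: Lp_space_def)
  show ?thesis
  proof (cases "p = \<infinity>")
    case True
    let ?F = "esssup M (\<lambda>x. ennreal \<bar>f x\<bar>)" and ?G = "esssup M (\<lambda>x. ennreal \<bar>g x\<bar>)"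
    have "esssup M (\<lambda>x. ennreal \<bar>f x + g x\<bar>) \<le> ?F + ?G"
    proof (rule esssup_I)
      show "AE x in M. ennreal \<bar>f x + g x\<bar> \<le> ?F + ?G"
        using esssup_AE[of "\<lambda>x. ennreal \<bar>f x\<bar>" M] esssup_AE[of "\<lambda>x. ennreal \<bar>g x\<bar>" M]
      proof eventually_elim
        case (elim x)
        have "ennreal \<bar>f x + g x\<bar> \<le> ennreal \<bar>f x\<bar> + ennreal \<bar>g x\<bar>"
          by (simp add: ennreal_leI abs_triangle_ineq flip: ennreal_plus)
        also have "\<dots> \<le> ?F + ?G" using elim by (rule add_mono)
        finally show ?case .
      qed
    qed measurable
    also have "\<dots> < \<infinity>" using f g True by (simp add: Lp_space_def)
    finally show ?thesis using True by (simp add: Lp_space_def)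
  next
    case False
    define P where "P = enn2real p"
    have P: "0 \<le> P" by (simp add: P_def)
    have int: "integrable M (\<lambda>x. 2 powr P * (\<bar>f x\<bar> powr P + \<bar>g x\<bar> powr P))"
      using f g False by (auto simp: Lp_space_def P_def)
    have "\<bar>f x + g x\<bar> powr P \<le> 2 powr P * (\<bar>f x\<bar> powr P + \<bar>g x\<bar> powr P)" for x
    proof -
      have "\<bar>f x + g x\<bar> powr P \<le> (2 * max \<bar>f x\<bar> \<bar>g x\<bar>) powr P"
        using P by (intro powr_mono2) auto
      also have "\<dots> = 2 powr P * max \<bar>f x\<bar> \<bar>g x\<bar> powr P" by (simp add: powr_mult)
      also have "\<dots> \<le> 2 powr P * (\<bar>f x\<bar> powr P + \<bar>g x\<bar> powr P)"
        by (intro mult_left_mono) (auto simp: max_def)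
      finally show ?thesis .
    qed
    then have "integrable M (\<lambda>x. \<bar>f x + g x\<bar> powr P)"
      by (intro Bochner_Integration.integrable_bound[OF int]) auto
    then show ?thesis using False by (simp add: Lp_space_def P_def)
  qed
qed

text \<open>The polarised form of the energy: on the diagonal it is twice
  \<open>kinetic_energy\<close>.\<close>

definition green_form :: "(real \<times> real \<Rightarrow> real) \<Rightarrow> (real \<times> real \<Rightarrow> real) \<Rightarrow> real" where
  "green_form \<omega> \<eta> = (\<integral>(x, y). green x y * \<omega> x * \<eta> y \<partial>(half_plane_measure \<Otimes>\<^sub>M half_plane_measure))"

lemma borel_measurable_green_form:
  assumes [measurable]: "\<omega> \<in> borel_measurable half_plane_measure" "\<eta> \<in> borel_measurable half_plane_measure"
  shows "(\<lambda>(x, y). green x y * \<omega> x * \<eta> y) \<in> borel_measurable (half_plane_measure \<Otimes>\<^sub>M half_plane_measure)"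
  using borel_measurable_green unfolding split_beta by measurable

lemma green_form_commute:
  assumes "\<omega> \<in> borel_measurable half_plane_measure" "\<eta> \<in> borel_measurable half_plane_measure"
  shows "green_form \<omega> \<eta> = green_form \<eta> \<omega>"
proof -
  interpret pair_sigma_finite half_plane_measure half_plane_measure
    by (rule pair_sigma_finite_half_plane)
  show ?thesis
    using integral_product_swap[OF borel_measurable_green_form[OF assms]]
    by (simp add: green_form_def green_commute mult_ac)
qed

text \<open>The kernel is nonnegative on the half-plane, so the nonnegative integral in the
  hypothesis is that of the absolute value of the integrand; its finiteness yields integrability and
  its bound passes to the signed integral.\<close>

lemma green_form_integrable:
  assumes m: "\<omega> \<in> borel_measurable half_plane_measure" "\<eta> \<in> borel_measurable half_plane_measure"
    and K: "0 \<le> K" "(\<integral>\<^sup>+ (x, y). ennreal (green x y * \<bar>\<omega> x * \<eta> y\<bar>)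
      \<partial>(half_plane_measure \<Otimes>\<^sub>M half_plane_measure)) \<le> ennreal K"
  shows "integrable (half_plane_measure \<Otimes>\<^sub>M half_plane_measure) (\<lambda>(x, y). green x y * \<omega> x * \<eta> y)"
    and "\<bar>green_form \<omega> \<eta>\<bar> \<le> K"
proof -
  let ?M2 = "half_plane_measure \<Otimes>\<^sub>M half_plane_measure" and ?f = "\<lambda>(x, y). green x y * \<omega> x * \<eta> y"
  have "(\<integral>\<^sup>+ z. ennreal (norm (?f z)) \<partial>?M2) = (\<integral>\<^sup>+ (x, y). ennreal (green x y * \<bar>\<omega> x * \<eta> y\<bar>) \<partial>?M2)"
    by (intro nn_integral_cong)
      (auto simp: space_pair_measure half_plane_def abs_mult green_nonneg mult.assoc)
  with K have le: "(\<integral>\<^sup>+ z. ennreal (norm (?f z)) \<partial>?M2) \<le> ennreal K" by simp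
  show int: "integrable ?M2 ?f"
    using le by (intro integrableI_bounded borel_measurable_green_form m) (auto intro: le_less_trans)
  have "ennreal (norm (integral\<^sup>L ?M2 ?f)) \<le> ennreal K"
    using integral_norm_bound_ennreal[OF int] le by (rule order_trans)
  then show "\<bar>green_form \<omega> \<eta>\<bar> \<le> K" using K by (simp add: green_form_def)
qed

section \<open>Deduction of the energy estimates from the bilinear bound\<close>

theorem lemma2p4:
  fixes p :: ennreal
  assumes "1 < p" and "p \<le> \<infinity>"
  shows "\<exists>C::real. C > 0 \<and>
    (\<forall>\<omega> \<eta> :: real \<times> real \<Rightarrow> real.
      \<omega> \<in> Lp_space half_plane_measure p \<longrightarrow>
      \<eta> \<in> Lp_space half_plane_measure p \<longrightarrow>
      (\<lambda>x. snd x * \<omega> x) \<in> Lp_space half_plane_measure 1 \<longrightarrow>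
      (\<lambda>x. snd x * \<eta> x) \<in> Lp_space half_plane_measure 1 \<longrightarrow>
        (\<integral>\<^sup>+ (x, y). ennreal (green x y * \<bar>\<omega> x * \<eta> y\<bar>)
             \<partial>(half_plane_measure \<Otimes>\<^sub>M half_plane_measure))
          \<le> ennreal (C
             * Lp_norm half_plane_measure 1 (\<lambda>x. snd x * \<omega> x) powr exponent 2 2 p
             * Lp_norm half_plane_measure p \<omega> powr exponent 1 0 p
             * Lp_norm half_plane_measure 1 (\<lambda>x. snd x * \<eta> x) powr exponent 2 2 p
             * Lp_norm half_plane_measure p \<eta> powr exponent 1 0 p)
        \<and> kinetic_energy \<omega>
          \<le> C * Lp_norm half_plane_measure 1 (\<lambda>x. snd x * \<omega> x) powr exponent 4 4 p
             * Lp_norm half_plane_measure p \<omega> powr exponent 2 0 p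
        \<and> \<bar>kinetic_energy \<omega> - kinetic_energy \<eta>\<bar>
          \<le> C * Lp_norm half_plane_measure 1 (\<lambda>x. snd x * (\<omega> x + \<eta> x)) powr exponent 2 2 p
             * Lp_norm half_plane_measure p (\<lambda>x. \<omega> x + \<eta> x) powr exponent 1 0 p
             * Lp_norm half_plane_measure 1 (\<lambda>x. snd x * (\<omega> x - \<eta> x)) powr exponent 2 2 p
             * Lp_norm half_plane_measure p (\<lambda>x. \<omega> x - \<eta> x) powr exponent 1 0 p)"
proof -
  let ?M = half_plane_measure
  let ?n1 = "\<lambda>f. Lp_norm ?M 1 (\<lambda>x. snd x * f x) powr exponent 2 2 p"
  let ?np = "\<lambda>f. Lp_norm ?M p f powr exponent 1 0 p"
  \<comment> \<open>The admissible functions; closure under sums and differences lets the bound be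
    used at \<open>\<omega> + \<eta>\<close> and \<open>\<omega> - \<eta>\<close>.\<close>
  define V where "V = {\<omega>. \<omega> \<in> Lp_space ?M p \<and> (\<lambda>x. snd x * \<omega> x) \<in> Lp_space ?M 1}"
  obtain C where C: "0 < C" and bound: "\<And>\<omega> \<eta>. \<omega> \<in> V \<Longrightarrow> \<eta> \<in> V \<Longrightarrow>
      (\<integral>\<^sup>+ (x, y). ennreal (green x y * \<bar>\<omega> x * \<eta> y\<bar>) \<partial>(?M \<Otimes>\<^sub>M ?M))
      \<le> ennreal (C * ?n1 \<omega> * ?np \<omega> * ?n1 \<eta> * ?np \<eta>)"
    unfolding V_def by (rule green_bilinear_bound[OF assms(1)]) blast
  have V_meas: "\<omega> \<in> borel_measurable ?M" if "\<omega> \<in> V" for \<omega> using that by (simp add: V_def Lp_space_def)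
  have V_add: "(\<lambda>x. \<omega> x + \<eta> x) \<in> V" if "\<omega> \<in> V" "\<eta> \<in> V" for \<omega> \<eta>
    using that Lp_space_add[of _ ?M] by (simp add: V_def distrib_left)
  have V_diff: "(\<lambda>x. \<omega> x - \<eta> x) \<in> V" if "\<omega> \<in> V" "\<eta> \<in> V" for \<omega> \<eta>
  proof -
    have "(\<lambda>x. - \<eta> x) \<in> V" using that Lp_space_uminus[of _ ?M] by (simp add: V_def)
    from V_add[OF that(1) this] show ?thesis by simp
  qed
  have form_int: "integrable (?M \<Otimes>\<^sub>M ?M) (\<lambda>(x, y). green x y * \<omega> x * \<eta> y)"
    and form_le: "\<bar>green_form \<omega> \<eta>\<bar> \<le> C * ?n1 \<omega> * ?np \<omega> * ?n1 \<eta> * ?np \<eta>"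
    if "\<omega> \<in> V" "\<eta> \<in> V" for \<omega> \<eta>
    using green_form_integrable[OF V_meas V_meas _ bound, OF that _ that] C by auto
  have energy: "kinetic_energy \<omega> = 1 / 2 * green_form \<omega> \<omega>" for \<omega>
    by (simp add: kinetic_energy_def green_form_def)
  \<comment> \<open>Polarisation: the four products are integrable, so the integral splits, and the
    two mixed terms cancel by \<open>green_form_commute\<close>.\<close>
  have polar: "green_form (\<lambda>x. \<omega> x + \<eta> x) (\<lambda>x. \<omega> x - \<eta> x) = green_form \<omega> \<omega> - green_form \<eta> \<eta>"
    if V: "\<omega> \<in> V" "\<eta> \<in> V" for \<omega> \<eta>
  proof -
    define g where "g \<omega> \<eta> = (\<lambda>(x, y). green x y * \<omega> x * \<eta> y)" for \<omega> \<eta> :: "real \<times> real \<Rightarrow> real"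
    have int: "integrable (?M \<Otimes>\<^sub>M ?M) (g \<omega> \<omega>)" "integrable (?M \<Otimes>\<^sub>M ?M) (g \<omega> \<eta>)"
      "integrable (?M \<Otimes>\<^sub>M ?M) (g \<eta> \<omega>)" "integrable (?M \<Otimes>\<^sub>M ?M) (g \<eta> \<eta>)"
      unfolding g_def by (rule form_int; fact)+
    have "green_form (\<lambda>x. \<omega> x + \<eta> x) (\<lambda>x. \<omega> x - \<eta> x)
        = (\<integral>z. (g \<omega> \<omega> z - g \<omega> \<eta> z) + (g \<eta> \<omega> z - g \<eta> \<eta> z) \<partial>(?M \<Otimes>\<^sub>M ?M))"
      unfolding green_form_def by (intro Bochner_Integration.integral_cong) (auto simp: g_def algebra_simps)
    also have "\<dots> = (green_form \<omega> \<omega> - green_form \<omega> \<eta>) + (green_form \<eta> \<omega> - green_form \<eta> \<eta>)"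
      using int by (simp add: green_form_def flip: g_def)
    finally show ?thesis using green_form_commute[of \<omega> \<eta>] V V_meas by simp
  qed
  \<comment> \<open>On the diagonal each norm occurs twice, which doubles the exponents.\<close>
  have ex: "exponent 4 4 p = exponent 2 2 p + exponent 2 2 p" "exponent 2 0 p = exponent 1 0 p + exponent 1 0 p"
    by (auto simp: exponent_alt[OF assms(1)] simp flip: add_divide_distrib)
  show ?thesis
  proof (intro exI[of _ C] conjI allI impI)
    show "0 < C" by fact
    fix \<omega> \<eta>
    assume "\<omega> \<in> Lp_space ?M p" "\<eta> \<in> Lp_space ?M p"
      "(\<lambda>x. snd x * \<omega> x) \<in> Lp_space ?M 1" "(\<lambda>x. snd x * \<eta> x) \<in> Lp_space ?M 1"
    then have V: "\<omega> \<in> V" "\<eta> \<in> V" by (auto simp: V_def)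
    show "(\<integral>\<^sup>+ (x, y). ennreal (green x y * \<bar>\<omega> x * \<eta> y\<bar>) \<partial>(?M \<Otimes>\<^sub>M ?M))
      \<le> ennreal (C * ?n1 \<omega> * ?np \<omega> * ?n1 \<eta> * ?np \<eta>)"
      by (rule bound[OF V])
    \<comment> \<open>The factor 1 / 2 of the energy is simply dropped, so the same \<open>C\<close>
      serves all three estimates.\<close>
    have half: "1 / 2 * r \<le> K" "\<bar>1 / 2 * r\<bar> \<le> K" if "\<bar>r\<bar> \<le> K" for r K :: real using that by auto
    have "kinetic_energy \<omega> \<le> C * ?n1 \<omega> * ?np \<omega> * ?n1 \<omega> * ?np \<omega>"
      unfolding energy by (rule half(1)[OF form_le[OF V(1) V(1)]])
    then show "kinetic_energy \<omega> \<le> C * Lp_norm ?M 1 (\<lambda>x. snd x * \<omega> x) powr exponent 4 4 p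
        * Lp_norm ?M p \<omega> powr exponent 2 0 p"
      by (simp only: ex powr_add mult_ac)
    have "kinetic_energy \<omega> - kinetic_energy \<eta> = 1 / 2 * green_form (\<lambda>x. \<omega> x + \<eta> x) (\<lambda>x. \<omega> x - \<eta> x)"
      unfolding energy polar[OF V] by (simp add: right_diff_distrib)
    then show "\<bar>kinetic_energy \<omega> - kinetic_energy \<eta>\<bar>
      \<le> C * ?n1 (\<lambda>x. \<omega> x + \<eta> x) * ?np (\<lambda>x. \<omega> x + \<eta> x) * ?n1 (\<lambda>x. \<omega> x - \<eta> x) * ?np (\<lambda>x. \<omega> x - \<eta> x)"
      using half(2)[OF form_le[OF V_add[OF V] V_diff[OF V]]] by simp
  qed
qed

end
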